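(* Let $\alpha\in[0,1]$. The function $x\mapsto -x\log_\alpha(x)$ is concave on $[0,1]$ if and only if $\alpha\le\alpha_*$ or $\alpha=1$, where $\alpha_*=0.771667...$ is the unique solution on $(0,1)$ of the equation (in the unknown $a$) $$\frac{1}{\Gamma(1-2a)^2}=\frac{1}{\Gamma(1-a)\,\Gamma(1-3a)}.$$
   Context: $1/\Gamma$ is the entire reciprocal Gamma function (equal to $0$ at the non-positive integers). For $\alpha\in(0,1]$, $E_\alpha(x)=\sum_{n\ge 0}\frac{x^n}{\Gamma(1+\alpha n)}$ is the Mittag-Leffler function, which is an increasing bijection from $\mathbb{R}$ onto $(0,\infty)$; for $\alpha=0$ one sets $E_0(x)=1/(1-x)$ on $(-\infty,1)$, an increasing bijection onto $(0,\infty)$. The generalized logarithm $\log_\alpha=E_\alpha^{-1}$ is the inverse function, defined on $(0,\infty)$ (so $\log_1=\log$ and $\log_0(x)=1-1/x$). The function $-x\log_\alpha(x)$ is extended to $x=0$ by continuity, with value $1/\Gamma(1-\alpha)$ (equal to $0$ for $\alpha=1$). *)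

theory Defs
  imports "HOL-Analysis.Analysis"
begin

text \<open>
  At \<open>\<alpha> = 0\<close> the series converges only on \<open>(-1, 1)\<close>; there the Mittag-Leffler function is
  taken to be \<open>1 / (1 - x)\<close> on all of \<open>(-\<infinity>, 1)\<close>.  Only arguments in \<open>mittag_leffler_domain \<alpha>\<close> are
  meaningful.
\<close>

definition mittag_leffler_domain :: "real \<Rightarrow> real set" where
  "mittag_leffler_domain \<alpha> = (if \<alpha> = 0 then {..<1} else UNIV)"

definition mittag_leffler :: "real \<Rightarrow> real \<Rightarrow> real" where
  "mittag_leffler \<alpha> x =
     (if \<alpha> = 0 then 1 / (1 - x) else (\<Sum>n. x ^ n / Gamma (1 + \<alpha> * real n)))"

definition gen_log :: "real \<Rightarrow> real \<Rightarrow> real" where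
  "gen_log \<alpha> = the_inv_into (mittag_leffler_domain \<alpha>) (mittag_leffler \<alpha>)"

text \<open>
  The function \<open>x \<mapsto> -x log\<^sub>\<alpha> x\<close> on \<open>[0, \<infinity>)\<close>.  Its value at \<open>0\<close> is the limit from the right,
  \<open>1 / \<Gamma>(1 - \<alpha>)\<close>.  The entire function \<open>rGamma\<close> is used because \<open>\<Gamma>\<close> has a pole at \<open>0\<close>,
  the relevant point for \<open>\<alpha> = 1\<close>.
\<close>

definition neg_x_gen_log :: "real \<Rightarrow> real \<Rightarrow> real" where
  "neg_x_gen_log \<alpha> x = (if x = 0 then rGamma (1 - \<alpha>) else - x * gen_log \<alpha> x)"

definition alpha_star_eq :: "real \<Rightarrow> bool" where
  "alpha_star_eq a \<longleftrightarrow> (rGamma (1 - 2 * a))\<^sup>2 = rGamma (1 - a) * rGamma (1 - 3 * a)"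

definition alpha_star :: real where
  "alpha_star = (THE a. a \<in> {0<..<1} \<and> alpha_star_eq a)"

end

theory Submission
  imports Defs
begin

text \<open>
  Write \<open>F s = E\<^sub>\<alpha> (-s)\<close> for \<open>s \<ge> 0\<close>. Since \<open>F s\<close> is mapped to \<open>s * F s\<close>, a perspective argument shows
  that the function is concave on \<open>[0, 1]\<close> iff \<open>1 / F\<close> is convex on \<open>[0, \<infinity>)\<close>.

  \<open>F\<close> is the limit of the functions \<open>s \<mapsto> \<Sum>\<^sub>j p\<^sub>m(j) / (1 + s m\<^sup>-\<^sup>\<alpha>)\<^sup>j\<^sup>+\<^sup>1\<close>, where \<open>p\<^sub>m\<close> is the law of the table
  count in a Chinese restaurant process. The differences of \<open>p\<^sub>m\<close> obey the same kind of recursion as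
  \<open>p\<^sub>m\<close>, which yields \<open>F s = a\<^sub>1 / s - a\<^sub>2 / s\<^sup>2 + a\<^sub>3 / s\<^sup>3 + O(s\<^sup>-\<^sup>4)\<close> with \<open>a\<^sub>k = 1 / \<Gamma>(1 - k \<alpha>)\<close>. Hence
  \<open>1 / F\<close> lies below its asymptote, and so is not convex, when \<open>a\<^sub>2\<^sup>2 < a\<^sub>1 a\<^sub>3\<close>.

  Conversely, if \<open>p\<^sub>m\<close> is log-concave then \<open>1 / F\<^sub>m\<close> is convex. The recursion preserves log-concavity away
  from \<open>j = 1\<close>, where the defect is a multiple of a finite approximation of \<open>a\<^sub>1 a\<^sub>3 - a\<^sub>2\<^sup>2\<close>. If
  \<open>a\<^sub>1 a\<^sub>3 \<le> a\<^sub>2\<^sup>2\<close>, this defect is too small to spoil log-concavity at \<open>j \<ge> 2\<close>, and the term \<open>j = 0\<close> can be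
  dropped since \<open>p\<^sub>m(0)\<close> tends to 0.

  Finally \<open>a\<^sub>1 a\<^sub>3 / a\<^sub>2\<^sup>2\<close> is strictly increasing on \<open>(2/3, 1)\<close> by the product formula for \<open>\<Gamma>\<close>, and rational
  bounds for the remainder of that product locate the point where it equals 1.
\<close>

subsection \<open>A recursion of Chinese restaurant type\<close>

text \<open>Gauss's limit for \<open>rGamma\<close>, with the last factor \<open>m + z\<close> of
  the Pochhammer symbol split off. At \<open>z = 1 - k * a\<close> it turns boundary values of the
  recursion into \<open>1 / Gamma (1 - k * a)\<close>, zeros included.\<close>

lemma pochhammer_asymp:
  fixes z :: real
  shows "(\<lambda>m. pochhammer z m / fact m * real m powr (1 - z)) \<longlonglongrightarrow> rGamma z"
proof -
  have "(\<lambda>m. rGamma_series z m * (real m / (real m + z))) \<longlonglongrightarrow> rGamma z * 1"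
  proof (intro tendsto_mult rGamma_series_LIMSEQ)
    show "(\<lambda>m. real m / (real m + z)) \<longlonglongrightarrow> 1"
    proof -
      have "(\<lambda>m. 1 / (1 + z * (1 / real m))) \<longlonglongrightarrow> 1 / (1 + z * 0)"
        by (intro tendsto_intros lim_1_over_n) auto
      moreover have "\<forall>\<^sub>F m in sequentially. 1 / (1 + z * (1 / real m)) = real m / (real m + z)"
        using eventually_gt_at_top[of "0::nat"] by eventually_elim (simp add: field_simps)
      ultimately show ?thesis by (simp add: tendsto_cong)
    qed
  qed
  moreover have "\<forall>\<^sub>F m in sequentially. rGamma_series z m * (real m / (real m + z))
      = pochhammer z m / fact m * real m powr (1 - z)"
    using eventually_gt_at_top[of "nat \<lceil>\<bar>z\<bar>\<rceil> + 1"]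
  proof eventually_elim
    case (elim m)
    then have m: "real m > 0" "real m + z > 0" by linarith+
    have "real m powr (1 - z) = real m / exp (z * ln (real m))"
      using m by (simp add: powr_def exp_diff algebra_simps)
    moreover have "pochhammer z (m + 1) = pochhammer z m * (real m + z)"
      by (simp add: pochhammer_rec' mult.commute add.commute)
    ultimately show ?case using m by (simp add: rGamma_series_def)
  qed
  ultimately show ?thesis by (simp add: tendsto_cong)
qed

text \<open>Row \<open>m\<close> is the law of the number of occupied tables, minus one, after \<open>m + 1\<close> customers of the
  Chinese restaurant process with discount \<open>a\<close>. At \<open>j = 0\<close> the junk value \<open>j - 1 = 0\<close> is harmless
  because its coefficient vanishes.\<close>

primrec crp :: "real \<Rightarrow> nat \<Rightarrow> nat \<Rightarrow> real" where
  "crp a 0 j = (if j = 0 then 1 else 0)"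
| "crp a (Suc m) j = ((real (Suc m) - a * (real j + 1)) * crp a m j + a * real j * crp a m (j - 1)) / real (Suc m)"

definition fdiff :: "(nat \<Rightarrow> real) \<Rightarrow> nat \<Rightarrow> real" where
  "fdiff q j = q (Suc j) - q j"

lemma crp_eq_0: "m < j \<Longrightarrow> crp a m j = 0"
  by (induction m arbitrary: j) auto

lemma crp_nonneg:
  assumes "0 \<le> a" "a \<le> 1"
  shows "0 \<le> crp a m j"
proof (induction m arbitrary: j)
  case (Suc m)
  show ?case
  proof (cases "j \<le> m")
    case True
    have "a * (real j + 1) \<le> 1 * real (Suc m)"
      using True assms by (intro mult_mono) auto
    then show ?thesis using Suc assms by simp
  next
    case False
    then show ?thesis using Suc assms by (simp add: crp_eq_0)
  qed
qed auto

lemma crp_pos: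
  assumes "0 < a" "a < 1" "j \<le> m"
  shows "0 < crp a m j"
  using \<open>j \<le> m\<close>
proof (induction m arbitrary: j)
  case (Suc m)
  show ?case
  proof (cases "j \<le> m")
    case True
    have "a * (real j + 1) < 1 * (real j + 1)"
      using assms by (intro mult_strict_right_mono) auto
    also have "\<dots> \<le> real (Suc m)" using True by simp
    finally have "0 < (real (Suc m) - a * (real j + 1)) * crp a m j"
      using Suc.IH[OF True] by simp
    moreover have "0 \<le> a * real j * crp a m (j - 1)"
      using assms crp_nonneg[of a m "j - 1"] by simp
    ultimately show ?thesis by (simp add: add_pos_nonneg)
  next
    case False
    then have "j = Suc m" using Suc.prems by simp
    then show ?thesis using Suc.IH[of m] assms by (simp add: crp_eq_0)
  qed
qed auto

text \<open>Discrete Leibniz rule: the coefficients are affine in \<open>j\<close> with slopes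
  \<open>-a\<close> and \<open>a\<close>, so each further difference just lowers the diagonal
  coefficient by another \<open>a\<close>. The inflow keeps its factor \<open>real j\<close>, which
  again neutralises \<open>j - 1\<close> at \<open>j = 0\<close>.\<close>

lemma fdiff_crp_Suc:
  "(fdiff ^^ i) (crp a (Suc m)) j =
     ((real (Suc m) - a * (real j + 1 + real i)) * (fdiff ^^ i) (crp a m) j
        + a * real j * (fdiff ^^ i) (crp a m) (j - 1)) / real (Suc m)"
proof (induction i arbitrary: j)
  case (Suc i)
  have IH: "real (Suc m) * (fdiff ^^ i) (crp a (Suc m)) k = (real (Suc m) - a * (real k + 1 + real i)) * (fdiff ^^ i) (crp a m) k
        + a * real k * (fdiff ^^ i) (crp a m) (k - 1)" for k
    by (subst Suc.IH) simp
  have "real (Suc m) * (fdiff ^^ Suc i) (crp a (Suc m)) j =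
     real (Suc m) * (fdiff ^^ i) (crp a (Suc m)) (Suc j) - real (Suc m) * (fdiff ^^ i) (crp a (Suc m)) j"
    by (simp add: fdiff_def right_diff_distrib del: crp.simps)
  also have "\<dots> = (real (Suc m) - a * (real j + 1 + real (Suc i))) * (fdiff ^^ Suc i) (crp a m) j
        + a * real j * (fdiff ^^ Suc i) (crp a m) (j - 1)"
    unfolding IH by (cases j) (simp_all add: fdiff_def algebra_simps)
  finally show ?case by (simp add: eq_divide_eq mult.commute del: crp.simps of_nat_Suc)
qed simp

lemma fdiff_crp_0: "(fdiff ^^ i) (crp a 0) j = (if j = 0 then (-1) ^ i else 0)"
  by (induction i arbitrary: j) (auto simp: fdiff_def)

lemma fdiff_crp_eq_0: "m < j \<Longrightarrow> (fdiff ^^ i) (crp a m) j = 0"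
  by (induction i arbitrary: j) (auto simp: fdiff_def crp_eq_0)

text \<open>At \<open>j = 0\<close> there is no inflow, so the recursion becomes a plain product.
  These boundary values supply the coefficients of the expansion of \<open>F\<close> at
  infinity.\<close>

lemma fdiff_crp_at_0:
  "(fdiff ^^ i) (crp a m) 0 = (-1) ^ i * pochhammer (1 - (real i + 1) * a) m / fact m"
proof (induction m)
  case 0
  show ?case by (simp add: fdiff_crp_0 del: crp.simps)
next
  case (Suc m)
  show ?case
    unfolding fdiff_crp_Suc Suc by (simp add: pochhammer_rec' field_simps)
qed

text \<open>Once both coefficients of the recursion are nonnegative, they add up to
  \<open>(n - b) / n\<close> with \<open>b = (i + 1) * a\<close>, so the sup norm of a row decays
  like \<open>n powr (- b)\<close>.\<close>

lemma fdiff_crp_bound: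
  assumes "0 < a" "a < 1"
  obtains C where "0 \<le> C" "\<And>m j. 0 < m \<Longrightarrow> \<bar>(fdiff ^^ i) (crp a m) j\<bar> \<le> C * real m powr (- ((real i + 1) * a))"
proof -
  define b where "b = (real i + 1) * a"
  \<comment> \<open>From \<open>M\<close> on, \<open>n * (1 - a) >= b\<close>. This makes the
    diagonal coefficient nonnegative inside the support, and bounds the lone inflow
    \<open>a * Suc n\<close> at the new index \<open>j = Suc n\<close> by
    \<open>Suc n - b\<close>.\<close>
  define M where "M = Suc (nat \<lceil>b / (1 - a)\<rceil>)"
  have b: "b \<ge> 0" using assms by (simp add: b_def)
  have M: "real n * (1 - a) \<ge> b" if "n \<ge> M" for n
  proof -
    have "real n \<ge> b / (1 - a)" using that unfolding M_def by linarith
    then show ?thesis using assms by (simp add: field_simps)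
  qed
  define K where "K n = (\<Sum>j\<le>n. \<bar>(fdiff ^^ i) (crp a n) j\<bar>)" for n
  have K: "\<bar>(fdiff ^^ i) (crp a n) j\<bar> \<le> K n" for n j
  proof (cases "j \<le> n")
    case True
    then show ?thesis unfolding K_def by (intro member_le_sum) auto
  next
    case False
    then show ?thesis by (simp add: fdiff_crp_eq_0 K_def sum_nonneg)
  qed
  have K0: "K n \<ge> 0" for n by (simp add: K_def sum_nonneg)
  \<comment> \<open>A sum over the finitely many early rows serves as their maximum.\<close>
  define C where "C = (\<Sum>n\<le>M. K n * real (Suc n) powr b)"
  have C: "K n * real (Suc n) powr b \<le> C" if "n \<le> M" for n
    unfolding C_def using that K0 by (intro member_le_sum) auto
  have C0: "C \<ge> 0" unfolding C_def using K0 by (intro sum_nonneg) auto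
  have *: "\<bar>(fdiff ^^ i) (crp a n) j\<bar> \<le> C * real (Suc n) powr (- b)" if "n \<ge> M" for n j
    using that
  proof (induction n arbitrary: j rule: dec_induct)
    case base
    have "\<bar>(fdiff ^^ i) (crp a M) j\<bar> \<le> K M" by (rule K)
    also have "K M = (K M * real (Suc M) powr b) * real (Suc M) powr (- b)"
      by (simp add: powr_minus)
    also have "\<dots> \<le> C * real (Suc M) powr (- b)" by (intro mult_right_mono C) auto
    finally show ?case .
  next
    case (step n)
    define S where "S = C * real (Suc n) powr (- b)"
    have n: "real n \<ge> 1" using step M_def by simp
    have S0: "S \<ge> 0" using C0 by (simp add: S_def)
    have IH: "\<bar>(fdiff ^^ i) (crp a n) j\<bar> \<le> S" for j using step S_def by simp
    have n1: "real (Suc n) * (1 - a) \<ge> b" by (rule M) (use step in simp)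
    have "real (Suc n) * \<bar>(fdiff ^^ i) (crp a (Suc n)) j\<bar> \<le> (real (Suc n) - b) * S"
    proof (cases "j \<le> n")
      case True
      have "a * (real j + 1 + real i) = a * (real j + 1) - a + b"
        by (simp add: b_def algebra_simps)
      also have "\<dots> \<le> a * real (Suc n) - a + b"
        using True assms by (intro add_right_mono diff_right_mono mult_left_mono) auto
      also have "\<dots> \<le> real (Suc n)" using n1 assms by (simp add: algebra_simps)
      finally have nn: "0 \<le> real (Suc n) - a * (real j + 1 + real i)" by simp
      have "real (Suc n) * \<bar>(fdiff ^^ i) (crp a (Suc n)) j\<bar>
          = \<bar>(real (Suc n) - a * (real j + 1 + real i)) * (fdiff ^^ i) (crp a n) j
        + a * real j * (fdiff ^^ i) (crp a n) (j - 1)\<bar>"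
        unfolding fdiff_crp_Suc by (simp add: abs_divide)
      also have "\<dots> \<le> (real (Suc n) - a * (real j + 1 + real i)) * S + a * real j * S"
        by (intro order.trans[OF abs_triangle_ineq] add_mono)
          (use nn IH assms in \<open>auto simp: abs_mult intro!: mult_left_mono\<close>)
      also have "\<dots> = (real (Suc n) - b) * S" by (simp add: b_def algebra_simps)
      finally show ?thesis .
    next
      case False
      show ?thesis
      proof (cases "j = Suc n")
        case True
        have "real (Suc n) * \<bar>(fdiff ^^ i) (crp a (Suc n)) j\<bar>
            = a * real (Suc n) * \<bar>(fdiff ^^ i) (crp a n) n\<bar>"
          unfolding fdiff_crp_Suc using True assms by (simp add: abs_divide fdiff_crp_eq_0 abs_mult)
        also have "\<dots> \<le> a * real (Suc n) * S"
          using IH assms by (intro mult_left_mono) auto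
        also have "\<dots> \<le> (real (Suc n) - b) * S"
          using n1 S0 by (intro mult_right_mono) (auto simp: algebra_simps)
        finally show ?thesis .
      next
        case False
        then have "j > Suc n" using \<open>\<not> j \<le> n\<close> by simp
        moreover have "real (Suc n) \<ge> b"
        proof -
          have "real (Suc n) * (1 - a) \<le> real (Suc n) * 1"
            using assms by (intro mult_left_mono) auto
          from order.trans[OF n1 this] show ?thesis by simp
        qed
        ultimately show ?thesis using S0 by (simp add: fdiff_crp_eq_0 del: crp.simps)
      qed
    qed
    then have "\<bar>(fdiff ^^ i) (crp a (Suc n)) j\<bar> \<le> (1 - b / real (Suc n)) * S"
      by (simp add: field_simps del: crp.simps)
    also have "\<dots> \<le> real (Suc n) powr b * real (Suc (Suc n)) powr (- b) * S"
    proof (intro mult_right_mono S0)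
      \<comment> \<open>With \<open>x = 1 / real (Suc n)\<close>:
        \<open>1 - b * x <= exp (- (b * x)) <= (1 + x) powr (- b)\<close>, so the contraction
        factors telescope into a power.\<close>
      have "ln (real (Suc (Suc n)) / real (Suc n)) \<le> real (Suc (Suc n)) / real (Suc n) - 1"
        by (intro ln_le_minus_one) auto
      also have "\<dots> = 1 / real (Suc n)" by (simp add: field_simps)
      finally have "b * (ln (real (Suc (Suc n))) - ln (real (Suc n))) \<le> b * (1 / real (Suc n))"
        using b by (intro mult_left_mono) (simp_all add: ln_div)
      then have "exp (- (b / real (Suc n))) \<le> exp (b * ln (real (Suc n)) - b * ln (real (Suc (Suc n))))"
        by (simp add: algebra_simps)
      also have "\<dots> = real (Suc n) powr b * real (Suc (Suc n)) powr (- b)"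
        by (simp add: powr_def exp_diff exp_minus field_simps)
      finally show "1 - b / real (Suc n) \<le> real (Suc n) powr b * real (Suc (Suc n)) powr (- b)"
        using exp_ge_add_one_self[of "- (b / real (Suc n))"] by simp
    qed
    also have "\<dots> = C * real (Suc (Suc n)) powr (- b)"
      by (simp add: S_def powr_minus field_simps)
    finally show ?case .
  qed
  show ?thesis
  proof
    show "0 \<le> C" by fact
    fix m j :: nat assume m: "0 < m"
    have "\<bar>(fdiff ^^ i) (crp a m) j\<bar> \<le> C * real (Suc m) powr (- b)"
    proof (cases "m \<ge> M")
      case False
      have "\<bar>(fdiff ^^ i) (crp a m) j\<bar> \<le> K m" by (rule K)
      also have "K m = (K m * real (Suc m) powr b) * real (Suc m) powr (- b)"
        by (simp add: powr_minus)
      also have "\<dots> \<le> C * real (Suc m) powr (- b)" using False by (intro mult_right_mono C) auto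
      finally show ?thesis .
    qed (rule *)
    also have "\<dots> \<le> C * real m powr (- b)"
      using m b C0 by (intro mult_left_mono powr_mono2') auto
    finally show "\<bar>(fdiff ^^ i) (crp a m) j\<bar> \<le> C * real m powr (- ((real i + 1) * a))"
      by (simp add: b_def)
  qed
qed

section \<open>Generating functions of the rows at \<open>1 / (1 + s)\<close>: expansions at
  infinity and at zero\<close>

definition gsum :: "(nat \<Rightarrow> real) \<Rightarrow> nat \<Rightarrow> real \<Rightarrow> real" where
  "gsum q m s = (\<Sum>j\<le>m. q j / (1 + s) ^ (j + 1))"

text \<open>Summation by parts, from \<open>s * y = 1 - y\<close> for
  \<open>y = 1 / (1 + s)\<close>; the vanishing entry at \<open>Suc m\<close> removes the upper
  boundary term. Iteration yields an expansion in powers of \<open>1 / s\<close>.\<close>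

lemma gsum_fdiff:
  assumes "0 \<le> s" "q (Suc m) = 0"
  shows "s * gsum q m s = q 0 + gsum (fdiff q) m s"
proof -
  define y where "y = 1 / (1 + s)"
  have y: "s * y = 1 - y" using assms(1) by (simp add: y_def field_simps)
  have g: "gsum r m s = (\<Sum>j\<le>m. r j * y ^ (j + 1))" for r :: "nat \<Rightarrow> real"
    unfolding gsum_def y_def by (simp only: power_one_over times_divide_eq_right mult_1_right)
  have "(\<Sum>j\<le>m. q (Suc j) * y ^ (j + 1)) = (\<Sum>j=Suc 0..Suc m. q j * y ^ j)"
    by (subst sum.shift_bounds_cl_Suc_ivl) (simp add: atMost_atLeast0)
  also have "\<dots> = (\<Sum>j\<le>Suc m. q j * y ^ j) - q 0"
    unfolding atMost_atLeast0 by (subst (2) sum.atLeast_Suc_atMost) auto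
  also have "\<dots> = (\<Sum>j\<le>m. q j * y ^ j) - q 0" using assms(2) by simp
  finally have "(\<Sum>j\<le>m. q (Suc j) * y ^ (j + 1)) = (\<Sum>j\<le>m. q j * y ^ j) - q 0" .
  then have "q 0 + gsum (fdiff q) m s = (\<Sum>j\<le>m. q j * y ^ j) - (\<Sum>j\<le>m. q j * y ^ (j + 1))"
    unfolding g by (simp add: fdiff_def left_diff_distrib sum_subtractf)
  also have "\<dots> = (\<Sum>j\<le>m. q j * y ^ j * (1 - y))"
    by (simp add: sum_subtractf[symmetric] algebra_simps)
  also have "\<dots> = s * gsum q m s"
    unfolding g by (simp add: y[symmetric] sum_distrib_left mult_ac)
  finally show ?thesis by simp
qed

lemma gsum_abs_le:
  assumes "0 < s" "\<And>j. \<bar>q j\<bar> \<le> B"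
  shows "\<bar>gsum q m s\<bar> \<le> B / s"
proof -
  have B: "0 \<le> B" using assms(2)[of 0] by simp
  have "\<bar>gsum q m s\<bar> \<le> (\<Sum>j\<le>m. B * (1 / (1 + s)) ^ (j + 1))"
    unfolding gsum_def
    by (rule order.trans[OF sum_abs sum_mono])
       (use assms in \<open>auto simp: abs_mult abs_divide power_one_over divide_right_mono\<close>)
  also have "\<dots> = B * ((1 / (1 + s)) * (\<Sum>j<Suc m. (1 / (1 + s)) ^ j))"
    by (simp only: sum_distrib_left lessThan_Suc_atMost power_add power_one_right mult_ac)
  also have "(\<Sum>j<Suc m. (1 / (1 + s)) ^ j) = (1 - (1 / (1 + s)) ^ Suc m) / (1 - 1 / (1 + s))"
    using assms(1) by (subst sum_gp_strict) auto
  also have "(1 / (1 + s)) * \<dots> = (1 - (1 / (1 + s)) ^ Suc m) / s"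
  proof -
    have "(1 / (1 + s)) * ((1 - z) / (1 - 1 / (1 + s))) = (1 - z) / s" for z
    proof -
      have "1 - 1 / (1 + s) = s / (1 + s)" using assms(1) by (simp add: field_simps)
      then show ?thesis using assms(1) by simp
    qed
    then show ?thesis .
  qed
  also have "B * \<dots> \<le> B * (1 / s)"
    using assms(1) B by (intro mult_left_mono divide_right_mono) auto
  finally show ?thesis by simp
qed

lemma DERIV_inverse_power_Suc:
  assumes "-1 < x"
  shows "((\<lambda>x::real. 1 / (1 + x) ^ (j + 1)) has_real_derivative - (real j + 1) * (1 / (1 + x) ^ (Suc j + 1))) (at x)"
  proof -
    have "((\<lambda>x. (1 + x) ^ (j + 1)) has_real_derivative real (j + 1) * (1 + x) ^ j) (at x)"
    proof -
      have "((\<lambda>x::real. 1 + x) has_real_derivative 1) (at x)" by (auto intro!: derivative_eq_intros)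
      from DERIV_power[OF this, of "j + 1"] show ?thesis by simp
    qed
    from DERIV_divide[OF DERIV_const[of 1] this]
    have "((\<lambda>x. 1 / (1 + x) ^ (j + 1)) has_real_derivative
       - (real (j + 1) * (1 + x) ^ j) / ((1 + x) ^ (j + 1) * (1 + x) ^ (j + 1))) (at x)"
      using assms by simp
    also have "- (real (j + 1) * (1 + x) ^ j) / ((1 + x) ^ (j + 1) * (1 + x) ^ (j + 1))
       = - (real j + 1) * (1 / (1 + x) ^ (Suc j + 1))"
      using assms by (simp add: divide_simps) (simp add: algebra_simps)?
    finally show ?thesis .
  qed

text \<open>The Taylor polynomials at 0 enclose the function alternately. The signed remainder of
  order \<open>Suc N\<close> at \<open>j\<close> vanishes at 0, and its derivative is
  \<open>j + 1\<close> times the signed remainder of order \<open>N\<close> at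
  \<open>Suc j\<close>.\<close>

lemma inverse_power_taylor:
  assumes "0 \<le> s"
  shows "0 \<le> (-1) ^ N * (1 / (1 + s) ^ (j + 1)
            - (\<Sum>i<N. (- s) ^ i * pochhammer (real j + 1) i / fact i))"
  using assms
proof (induction N arbitrary: s j)
  case (Suc N)
  define T where "T N j s = (\<Sum>i<N. (- s) ^ i * pochhammer (real j + 1) i / fact i)" for N j s
  define f where "f s = (-1) ^ Suc N * (1 / (1 + s) ^ (j + 1) - T (Suc N) j s)" for s
  define f' where "f' s = (real j + 1) * ((-1) ^ N * (1 / (1 + s) ^ (Suc j + 1) - T N (Suc j) s))" for s
  have T: "(T (Suc N) j has_real_derivative - (real j + 1) * T N (Suc j) s) (at s)" for s
  proof -
    have "(T (Suc N) j has_real_derivative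
        (\<Sum>i<Suc N. real i * (- s) ^ (i - 1) * (- 1) * pochhammer (real j + 1) i / fact i)) (at s)"
      unfolding T_def by (auto intro!: derivative_eq_intros)
    also have "(\<Sum>i<Suc N. real i * (- s) ^ (i - 1) * (- 1) * pochhammer (real j + 1) i / fact i)
      = (\<Sum>i<N. real (Suc i) * (- s) ^ i * (- 1) * pochhammer (real j + 1) (Suc i) / fact (Suc i))"
      by (subst sum.lessThan_Suc_shift) simp
    also have "\<dots> = - (real j + 1) * T N (Suc j) s"
      unfolding T_def sum_distrib_left
    proof (intro sum.cong refl)
      fix i
      have "pochhammer (real j + 1) (Suc i) = (real j + 1) * pochhammer (real (Suc j) + 1) i"
        by (simp add: pochhammer_rec add_ac)
      then show "real (Suc i) * (- s) ^ i * (- 1) * pochhammer (real j + 1) (Suc i) / fact (Suc i)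
        = - (real j + 1) * ((- s) ^ i * pochhammer (real (Suc j) + 1) i / fact i)"
        by (simp add: divide_simps del: of_nat_Suc) (simp add: algebra_simps)?
    qed
    finally show ?thesis .
  qed
  have "f 0 \<le> f s"
  proof (rule DERIV_nonneg_imp_nondecreasing[OF Suc.prems])
    fix x :: real assume x: "0 \<le> x" "x \<le> s"
    have "((\<lambda>x. 1 / (1 + x) ^ (j + 1)) has_real_derivative - (real j + 1) * (1 / (1 + x) ^ (Suc j + 1))) (at x)"
      using x by (intro DERIV_inverse_power_Suc) simp
    then have "(f has_real_derivative f' x) (at x)"
    proof -
      assume "((\<lambda>x. 1 / (1 + x) ^ (j + 1)) has_real_derivative - (real j + 1) * (1 / (1 + x) ^ (Suc j + 1))) (at x)"
      from DERIV_cmult[OF DERIV_diff[OF this T[of x]], of "(-1) ^ Suc N"]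
      show ?thesis unfolding f_def f'_def by (rule back_subst) (simp add: algebra_simps)
    qed
    moreover have "f' x \<ge> 0"
      unfolding f'_def T_def using Suc.IH[OF x(1), of "Suc j"] by simp
    ultimately show "\<exists>y. (f has_real_derivative y) (at x) \<and> 0 \<le> y" by blast
  qed
  moreover have "f 0 = 0"
    unfolding f_def T_def by (subst sum.lessThan_Suc_shift) simp
  ultimately show ?case unfolding f_def T_def by simp
qed simp

text \<open>Rising factorials are eigenfunctions of the recursion:
  \<open>(j + 1) * (w (j + 1) - w j) = i * w j\<close>, so each step multiplies the moment by
  \<open>(1 + a * i + m) / (m + 1)\<close>.\<close>

lemma crp_rising_moment:
  "(\<Sum>j\<le>m. crp a m j * pochhammer (real j + 1) i) = fact i * pochhammer (1 + a * real i) m / fact m"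
proof (induction m)
  case 0
  show ?case by (simp add: pochhammer_fact)
next
  case (Suc m)
  define w where "w j = pochhammer (real j + 1) i" for j :: nat
  have w: "(real j + 1) * (w (Suc j) - w j) = real i * w j" for j
  proof -
    have "(real j + 1) * w (Suc j) = pochhammer (real j + 1) (Suc i)"
      by (simp add: w_def pochhammer_rec add_ac)
    also have "\<dots> = (real j + 1 + real i) * w j"
      by (simp add: w_def pochhammer_rec')
    finally show ?thesis by (simp add: algebra_simps)
  qed
  have "real (Suc m) * (\<Sum>j\<le>Suc m. crp a (Suc m) j * w j)
     = (\<Sum>j\<le>Suc m. (real (Suc m) - a * (real j + 1)) * crp a m j * w j)
       + (\<Sum>j\<le>Suc m. a * real j * crp a m (j - 1) * w j)"
    unfolding sum_distrib_left sum.distrib[symmetric]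
  proof (intro sum.cong refl)
    fix j
    have "real (Suc m) * crp a (Suc m) j = (real (Suc m) - a * (real j + 1)) * crp a m j + a * real j * crp a m (j - 1)"
      by simp
    then show "real (Suc m) * (crp a (Suc m) j * w j)
        = (real (Suc m) - a * (real j + 1)) * crp a m j * w j + a * real j * crp a m (j - 1) * w j"
      by (metis distrib_right mult.assoc)
  qed
  also have "(\<Sum>j\<le>Suc m. a * real j * crp a m (j - 1) * w j) =
      (\<Sum>j\<le>m. a * (real j + 1) * crp a m j * w (Suc j))"
    by (subst sum.atMost_Suc_shift) (simp add: add_ac)
  also have "(\<Sum>j\<le>Suc m. (real (Suc m) - a * (real j + 1)) * crp a m j * w j)
     = (\<Sum>j\<le>m. (real (Suc m) - a * (real j + 1)) * crp a m j * w j)"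
    by (simp add: crp_eq_0)
  also have "\<dots> + (\<Sum>j\<le>m. a * (real j + 1) * crp a m j * w (Suc j)) =
      (\<Sum>j\<le>m. crp a m j * (real (Suc m) * w j + a * ((real j + 1) * (w (Suc j) - w j))))"
    by (simp add: sum.distrib[symmetric] algebra_simps)
  also have "\<dots> = (1 + a * real i + real m) * (\<Sum>j\<le>m. crp a m j * w j)"
    unfolding w sum_distrib_left by (intro sum.cong) (simp_all add: algebra_simps)
  also have "\<dots> = real (Suc m) * (fact i * pochhammer (1 + a * real i) (Suc m) / fact (Suc m))"
    unfolding w_def Suc by (simp add: pochhammer_rec' del: of_nat_Suc)
  finally show ?case unfolding w_def mult_left_cancel[OF of_nat_neq_0] .
qed

text \<open>The enclosure of \<open>inverse_power_taylor\<close>, averaged with the nonnegative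
  weights of row \<open>m\<close>.\<close>

lemma gsum_crp_taylor:
  assumes "0 \<le> a" "a \<le> 1" "0 \<le> s"
  shows "0 \<le> (-1) ^ N * (gsum (crp a m) m s
            - (\<Sum>i<N. (- s) ^ i * (pochhammer (1 + a * real i) m / fact m)))"
proof -
  have "0 \<le> (\<Sum>j\<le>m. crp a m j * ((-1) ^ N * (1 / (1 + s) ^ (j + 1)
            - (\<Sum>i<N. (- s) ^ i * pochhammer (real j + 1) i / fact i))))"
    using assms by (intro sum_nonneg mult_nonneg_nonneg crp_nonneg inverse_power_taylor) auto
  also have "\<dots> = (-1) ^ N * (gsum (crp a m) m s
       - (\<Sum>j\<le>m. \<Sum>i<N. (- s) ^ i / fact i * (crp a m j * pochhammer (real j + 1) i)))"
    by (simp add: gsum_def right_diff_distrib sum_subtractf sum_distrib_left mult_ac)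
  also have "(\<Sum>j\<le>m. \<Sum>i<N. (- s) ^ i / fact i * (crp a m j * pochhammer (real j + 1) i))
     = (\<Sum>i<N. (- s) ^ i * (pochhammer (1 + a * real i) m / fact m))"
    by (subst sum.swap) (simp add: sum_distrib_left[symmetric] sum_divide_distrib[symmetric] crp_rising_moment)
  finally show ?thesis .
qed

subsection \<open>The Mittag-Leffler function as a limit\<close>

text \<open>Log-convexity of \<open>Gamma\<close> at \<open>1 + x\<close>, which divides the segment
  from \<open>x\<close> to \<open>1 + x + a\<close> with weights \<open>a / (1 + a)\<close> and
  \<open>1 / (1 + a)\<close>.\<close>

lemma Gamma_add_ge:
  fixes x a :: real
  assumes "0 < x" "0 < a"
  shows "Gamma (1 + x) * x powr a \<le> Gamma (1 + x + a)"
proof -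
  have G: "Gamma (1 + x) = x * Gamma x"
    using Gamma_plus1[of x] assms by (simp add: add.commute nonpos_Ints_def)
  have Gp: "Gamma x > 0" "Gamma (1 + x) > 0" "Gamma (1 + x + a) > 0"
    using assms by (auto intro!: Gamma_real_pos)
  have "(ln \<circ> Gamma) ((1 - 1 / (1 + a)) *\<^sub>R x + (1 / (1 + a)) *\<^sub>R (1 + x + a))
       \<le> (1 - 1 / (1 + a)) * (ln \<circ> Gamma) x + (1 / (1 + a)) * (ln \<circ> Gamma) (1 + x + a)"
    using assms by (intro convex_onD[OF log_convex_Gamma_real]) auto
  also have "(1 - 1 / (1 + a)) *\<^sub>R x + (1 / (1 + a)) *\<^sub>R (1 + x + a) = 1 + x"
  proof -
    define t where "t = 1 / (1 + a)"
    have "t * (1 + a) = 1" using assms by (simp add: t_def)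
    then have "(1 - t) *\<^sub>R x + t *\<^sub>R (1 + x + a) = 1 + x" by (simp add: algebra_simps)
    then show ?thesis by (simp add: t_def)
  qed
  finally have "(1 + a) * ln (Gamma (1 + x))
      \<le> (1 + a) * ((1 - 1 / (1 + a)) * ln (Gamma x) + (1 / (1 + a)) * ln (Gamma (1 + x + a)))"
    using assms by (intro mult_left_mono) simp_all
  also have "\<dots> = a * ln (Gamma x) + ln (Gamma (1 + x + a))"
  proof -
    have "(1 + a) * (1 - 1 / (1 + a)) = a" "(1 + a) * (1 / (1 + a)) = 1"
      using assms by (simp_all add: right_diff_distrib)
    then show ?thesis by (metis distrib_left mult.assoc mult_1)
  qed
  also have "ln (Gamma x) = ln (Gamma (1 + x)) - ln x"
    unfolding G using assms Gp(1) by (subst ln_mult_pos) auto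
  finally have "ln (Gamma (1 + x)) + a * ln x \<le> ln (Gamma (1 + x + a))"
    by (simp add: algebra_simps)
  then have "exp (ln (Gamma (1 + x)) + a * ln x) \<le> exp (ln (Gamma (1 + x + a)))"
    by simp
  then show ?thesis using Gp assms by (simp add: exp_add powr_def)
qed

lemma summable_mittag_leffler:
  fixes x a :: real
  assumes "0 < a"
  shows "summable (\<lambda>n. x ^ n * rGamma (1 + a * real n))"
proof -
  \<comment> \<open>From \<open>N\<close> on, \<open>(a * n) powr a >= 2 * \<bar>x\<bar>\<close>, so
    \<open>Gamma_add_ge\<close> makes the ratio of consecutive terms at most
    \<open>1/2\<close>.\<close>
  define N where "N = Suc (nat \<lceil>(2 * \<bar>x\<bar>) powr (1 / a) / a\<rceil>)"
  show ?thesis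
  proof (rule summable_ratio_test[of "1/2" N])
    fix n assume n: "n \<ge> N"
    have an: "a * real n > 0" using n assms by (simp add: N_def)
    have "(2 * \<bar>x\<bar>) powr (1 / a) / a \<le> real n" using n unfolding N_def by linarith
    then have "(2 * \<bar>x\<bar>) powr (1 / a) \<le> a * real n" using assms by (simp add: field_simps)
    then have "((2 * \<bar>x\<bar>) powr (1 / a)) powr a \<le> (a * real n) powr a"
      using assms by (intro powr_mono2) auto
    then have x: "2 * \<bar>x\<bar> \<le> (a * real n) powr a"
      using assms by (simp add: powr_powr)
    have "Gamma (1 + a * real n) * (2 * \<bar>x\<bar>) \<le> Gamma (1 + a * real n) * (a * real n) powr a"
      using x an by (intro mult_left_mono) (auto intro!: less_imp_le Gamma_real_pos)
    also have "\<dots> \<le> Gamma (1 + a * real n + a)" using an assms by (intro Gamma_add_ge)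
    finally have "\<bar>x\<bar> * rGamma (1 + a * real n + a) \<le> 1/2 * rGamma (1 + a * real n)"
      using an assms Gamma_real_pos[of "1 + a * real n"] Gamma_real_pos[of "1 + a * real n + a"]
      by (simp add: rGamma_inverse_Gamma field_simps)
    then have "\<bar>x\<bar> ^ n * (\<bar>x\<bar> * rGamma (1 + a * real n + a)) \<le> \<bar>x\<bar> ^ n * (1/2 * rGamma (1 + a * real n))"
      by (intro mult_left_mono) auto
    moreover have "rGamma (1 + a * real n) > 0" "rGamma (1 + a * real n + a) > 0"
      using an assms by (auto simp: rGamma_inverse_Gamma intro!: Gamma_real_pos)
    ultimately show "norm (x ^ Suc n * rGamma (1 + a * real (Suc n))) \<le> 1/2 * norm (x ^ n * rGamma (1 + a * real n))"
      by (simp add: abs_mult power_abs algebra_simps)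
  qed simp
qed

lemma mittag_leffler_eq:
  "a \<noteq> 0 \<Longrightarrow> mittag_leffler a x = (\<Sum>n. x ^ n * rGamma (1 + a * real n))"
  by (simp add: mittag_leffler_def rGamma_inverse_Gamma divide_inverse)

text \<open>The alternating enclosure controls the truncation error at order \<open>N\<close> by the
  gap to the Taylor sum of order \<open>Suc N\<close>, for every \<open>m\<close>. Hence
  \<open>N\<close> can be fixed from the limit series first, and then \<open>m\<close> sent to
  infinity in two finite sums.\<close>

lemma gsum_crp_LIMSEQ:
  assumes a: "0 < a" "a \<le> 1" and s: "0 \<le> s"
  shows "(\<lambda>m. gsum (crp a m) m (s * real m powr (- a))) \<longlonglongrightarrow> mittag_leffler a (- s)"
proof -
  define E where "E = mittag_leffler a (- s)"
  define U where "U N m = (\<Sum>i<N. (- (s * real m powr (- a))) ^ i * (pochhammer (1 + a * real i) m / fact m))" for N m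
  define T where "T N = (\<Sum>i<N. (- s) ^ i * rGamma (1 + a * real i))" for N
  define g where "g m = gsum (crp a m) m (s * real m powr (- a))" for m
  have T: "T \<longlonglongrightarrow> E"
    using summable_LIMSEQ[OF summable_mittag_leffler[OF a(1), of "- s"]] a
    by (simp add: T_def[abs_def] E_def mittag_leffler_eq)
  have U: "U N \<longlonglongrightarrow> T N" for N
  proof -
    have "(\<lambda>m. \<Sum>i<N. (- s) ^ i * (pochhammer (1 + a * real i) m / fact m * real m powr (1 - (1 + a * real i)))) \<longlonglongrightarrow> T N"
      unfolding T_def by (intro tendsto_sum tendsto_mult tendsto_const pochhammer_asymp)
    moreover have "\<forall>\<^sub>F m in sequentially. (\<Sum>i<N. (- s) ^ i * (pochhammer (1 + a * real i) m / fact m * real m powr (1 - (1 + a * real i)))) = U N m"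
      using eventually_gt_at_top[of "0::nat"]
    proof eventually_elim
      case (elim m)
      have "real m powr (1 - (1 + a * real i)) = (real m powr (- a)) ^ i" for i
        using elim by (simp add: powr_power mult.commute)
      then show ?case
        unfolding U_def by (intro sum.cong) (simp_all add: power_mult_distrib[symmetric] mult_ac)
    qed
    ultimately show ?thesis by (simp add: tendsto_cong)
  qed
  have g: "\<bar>g m - U N m\<bar> \<le> \<bar>U (Suc N) m - U N m\<bar>" for m N
  proof -
    have s': "0 \<le> s * real m powr (- a)" using s by simp
    have "0 \<le> (-1) ^ N * (g m - U N m)" "0 \<le> (-1) ^ Suc N * (g m - U (Suc N) m)"
      using gsum_crp_taylor[of a "s * real m powr (- a)" N m] gsum_crp_taylor[of a "s * real m powr (- a)" "Suc N" m] s' a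
      unfolding g_def U_def by auto
    then show ?thesis by (cases "even N") (auto simp: abs_if)
  qed
  have "g \<longlonglongrightarrow> E"
  proof (rule LIMSEQ_I)
    fix e :: real assume e: "0 < e"
    have "\<forall>\<^sub>F N in sequentially. dist (T N) E < e / 8"
      using tendstoD[OF T, of "e / 8"] e by simp
    then obtain N where N: "\<And>n. n \<ge> N \<Longrightarrow> \<bar>T n - E\<bar> < e / 8"
      by (auto simp: eventually_sequentially dist_real_def)
    have "\<forall>\<^sub>F m in sequentially. \<bar>U N m - T N\<bar> < e / 8 \<and> \<bar>U (Suc N) m - T (Suc N)\<bar> < e / 8"
      using tendstoD[OF U[of N], of "e / 8"] tendstoD[OF U[of "Suc N"], of "e / 8"] e
      by (simp add: dist_real_def eventually_conj)
    then obtain M where M: "\<And>m. m \<ge> M \<Longrightarrow> \<bar>U N m - T N\<bar> < e / 8 \<and> \<bar>U (Suc N) m - T (Suc N)\<bar> < e / 8"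
      by (auto simp: eventually_sequentially)
    have "norm (g m - E) < e" if "m \<ge> M" for m
      using M[OF that] N[of N] N[of "Suc N"] g[of m N] by (simp add: abs_if split: if_splits)
    then show "\<exists>M. \<forall>m\<ge>M. norm (g m - E) < e" by blast
  qed
  then show ?thesis by (simp add: g_def[abs_def] E_def)
qed

text \<open>Three summations by parts in row \<open>m\<close>, with \<open>u = m powr (- a)\<close>
  and \<open>t = s * u\<close>. The boundary terms scale like \<open>u\<close>, \<open>u^2\<close>,
  \<open>u^3\<close> and the remainder is at most \<open>C * u^4 / t\<close>; after division by
  \<open>u^3\<close> the error bound \<open>C / s\<close> is uniform in \<open>m\<close> and
  survives the limit.\<close>

lemma mittag_leffler_asymp:
  assumes a: "0 < a" "a < 1"
  obtains C where "\<And>s. 0 < s \<Longrightarrow> \<bar>s ^ 3 * mittag_leffler a (- s)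
       - (s\<^sup>2 * rGamma (1 - a) - s * rGamma (1 - 2 * a) + rGamma (1 - 3 * a))\<bar> \<le> C / s"
proof -
  obtain C where C: "0 \<le> C" "\<And>m j. 0 < m \<Longrightarrow> \<bar>(fdiff ^^ 3) (crp a m) j\<bar> \<le> C * real m powr (- ((real 3 + 1) * a))"
    using fdiff_crp_bound[OF a] by metis
  have "\<bar>s ^ 3 * mittag_leffler a (- s)
       - (s\<^sup>2 * rGamma (1 - a) - s * rGamma (1 - 2 * a) + rGamma (1 - 3 * a))\<bar> \<le> C / s" if s: "0 < s" for s
  proof (rule Lim_bounded)
    define c where "c k m = pochhammer (1 - real k * a) m / fact m * real m powr (1 - (1 - real k * a))" for k m :: nat
    define g where "g m = gsum (crp a m) m (s * real m powr (- a))" for m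
    have c: "c k \<longlonglongrightarrow> rGamma (1 - real k * a)" for k
      unfolding c_def by (rule pochhammer_asymp)
    have g: "g \<longlonglongrightarrow> mittag_leffler a (- s)"
      unfolding g_def using a s by (intro gsum_crp_LIMSEQ) auto
    show "(\<lambda>m. \<bar>s ^ 3 * g m - (s\<^sup>2 * c 1 m - s * c 2 m + c 3 m)\<bar>) \<longlonglongrightarrow>
       \<bar>s ^ 3 * mittag_leffler a (- s)
       - (s\<^sup>2 * rGamma (1 - a) - s * rGamma (1 - 2 * a) + rGamma (1 - 3 * a))\<bar>"
      using c[of 1] c[of 2] c[of 3] by (intro tendsto_intros g) simp_all
    show "\<forall>m\<ge>1. \<bar>s ^ 3 * g m - (s\<^sup>2 * c 1 m - s * c 2 m + c 3 m)\<bar> \<le> C / s"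
    proof (intro allI impI)
      fix m :: nat assume m: "m \<ge> 1"
      define u where "u = real m powr (- a)"
      define t where "t = s * u"
      define q where "q = crp a m"
      have u: "0 < u" using m by (simp add: u_def)
      have t: "0 < t" using u s by (simp add: t_def)
      have uk: "real m powr (real k * a) = 1 / u ^ k" for k
        using m by (simp add: u_def powr_power powr_minus field_simps)
      have z: "(fdiff ^^ i) q (Suc m) = 0" for i
        unfolding q_def by (rule fdiff_crp_eq_0) simp
      have R: "\<bar>gsum ((fdiff ^^ 3) q) m t\<bar> \<le> C * u ^ 4 / t"
      proof (rule gsum_abs_le[OF t])
        fix j
        have "real m powr (- ((real 3 + 1) * a)) = u ^ 4"
          using m by (simp add: u_def powr_power)
        then show "\<bar>(fdiff ^^ 3) q j\<bar> \<le> C * u ^ 4" using C(2)[of m j] m by (simp add: q_def)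
      qed
      have "t * gsum ((fdiff ^^ i) q) m t = (fdiff ^^ i) q 0 + gsum ((fdiff ^^ Suc i) q) m t" for i
        using gsum_fdiff[of t "(fdiff ^^ i) q" m] t z by simp
      from this[of 0] this[of 1] this[of 2]
      have "t ^ 3 * gsum q m t = t\<^sup>2 * q 0 + t * fdiff q 0 + (fdiff ^^ 2) q 0 + gsum ((fdiff ^^ 3) q) m t"
        by (simp add: numeral_eq_Suc algebra_simps)
      moreover have "q 0 = u * c 1 m" "fdiff q 0 = - (u ^ 2 * c 2 m)" "(fdiff ^^ 2) q 0 = u ^ 3 * c 3 m"
        using fdiff_crp_at_0[of 0 a m] fdiff_crp_at_0[of 1 a m] fdiff_crp_at_0[of 2 a m] uk[of 1] uk[of 2] uk[of 3] u
        by (simp_all add: q_def c_def)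
      ultimately have "gsum ((fdiff ^^ 3) q) m t = u ^ 3 * (s ^ 3 * g m - (s\<^sup>2 * c 1 m - s * c 2 m + c 3 m))"
        by (simp add: t_def g_def u_def[symmetric] q_def[symmetric] algebra_simps power2_eq_square power3_eq_cube)
      then have "u ^ 3 * \<bar>s ^ 3 * g m - (s\<^sup>2 * c 1 m - s * c 2 m + c 3 m)\<bar> = \<bar>gsum ((fdiff ^^ 3) q) m t\<bar>"
        using u by (simp add: abs_mult)
      also have "\<dots> \<le> u ^ 3 * (C / s)"
        using R u s by (simp add: t_def power_numeral_reduce mult_ac)
      finally show "\<bar>s ^ 3 * g m - (s\<^sup>2 * c 1 m - s * c 2 m + c 3 m)\<bar> \<le> C / s"
        using u by (simp only: mult_le_cancel_left_pos zero_less_power)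
    qed
  qed
  then show ?thesis by (rule that)
qed

subsection \<open>Convexity from log-concavity\<close>

lemma sum_shift_0:
  fixes g :: "nat \<Rightarrow> real"
  assumes "g 0 = 0" "g (Suc m) = 0"
  shows "(\<Sum>j\<le>m. g (Suc j)) = (\<Sum>j\<le>m. g j)"
  using sum.atMost_Suc_shift[of g m] assms by simp

text \<open>The ratios \<open>q (Suc j) / q j\<close> decrease along the support. Since the support
  is the interval from 1 to \<open>m\<close>, the intermediate entry can be cancelled in the
  induction.\<close>

lemma log_concave_cross:
  fixes q :: "nat \<Rightarrow> real"
  assumes q: "q 0 = 0" "\<And>j. 1 \<le> j \<Longrightarrow> j \<le> m \<Longrightarrow> 0 < q j" "\<And>j. m < j \<Longrightarrow> q j = 0"
    and lc: "\<And>j. 2 \<le> j \<Longrightarrow> q (j - 1) * q (j + 1) \<le> (q j)\<^sup>2"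
    and "i \<le> j"
  shows "q i * q (Suc j) \<le> q (Suc i) * q j"
proof -
  have nonneg: "0 \<le> q k" for k
    using q(1) q(2)[of k] q(3)[of k] by (cases "k = 0"; cases "k \<le> m") auto
  show ?thesis
    using \<open>i \<le> j\<close>
  proof (induction j rule: dec_induct)
    case (step k)
    show ?case
    proof (cases "i = 0 \<or> m < Suc (Suc k)")
      case True
      then show ?thesis using q(1) q(3)[of "Suc (Suc k)"] nonneg by auto
    next
      case False
      then have pos: "0 < q k" using step by (intro q(2)) auto
      have "q k * (q i * q (Suc (Suc k))) = q i * (q k * q (Suc (Suc k)))" by simp
      also have "\<dots> \<le> q i * (q (Suc k))\<^sup>2"
        using lc[of "Suc k"] False step by (intro mult_left_mono nonneg) auto
      also have "\<dots> = (q i * q (Suc k)) * q (Suc k)" by (simp add: power2_eq_square)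
      also have "\<dots> \<le> (q (Suc i) * q k) * q (Suc k)"
        using step by (intro mult_right_mono nonneg)
      also have "\<dots> = q k * (q (Suc i) * q (Suc k))" by simp
      finally show ?thesis using pos by simp
    qed
  qed simp
qed

text \<open>For \<open>z = (1 - t) * x + t * y\<close>, the point \<open>1 / z\<close> is the convex
  combination of \<open>1 / x\<close> and \<open>1 / y\<close> with weights
  \<open>(1 - t) * x / z\<close> and \<open>t * y / z\<close>.\<close>

lemma convex_on_perspective:
  fixes f :: "real \<Rightarrow> real"
  assumes "convex_on {0<..} f"
  shows "convex_on {0<..} (\<lambda>z. z * f (1 / z))"
proof (rule convex_onI)
  fix t x y :: real
  assume t: "0 < t" "t < 1" and xy: "x \<in> {0<..}" "y \<in> {0<..}"
  define z where "z = (1 - t) * x + t * y"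
  have z: "0 < z" using t xy by (simp add: z_def add_pos_pos)
  define w where "w = t * y / z"
  have w: "0 \<le> w" "w \<le> 1" "1 - w = (1 - t) * x / z"
    using t xy z by (simp_all add: w_def field_simps) (simp_all add: z_def algebra_simps)
  have eq: "(1 - w) * (1 / x) + w * (1 / y) = 1 / z"
    using xy z unfolding w(3) unfolding w_def by (simp add: add_divide_distrib[symmetric])
  have "f ((1 - w) *\<^sub>R (1 / x) + w *\<^sub>R (1 / y)) \<le> (1 - w) * f (1 / x) + w * f (1 / y)"
    using w xy by (intro convex_onD[OF assms]) auto
  then have "z * f (1 / z) \<le> z * ((1 - w) * f (1 / x) + w * f (1 / y))"
    using z by (simp add: eq[simplified])
  also have "\<dots> = (1 - t) * (x * f (1 / x)) + t * (y * f (1 / y))"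
    using z unfolding w(3) unfolding w_def by (simp add: field_simps)
  finally show "((1 - t) *\<^sub>R x + t *\<^sub>R y) * f (1 / ((1 - t) *\<^sub>R x + t *\<^sub>R y))
      \<le> (1 - t) * (x * f (1 / x)) + t * (y * f (1 / y))"
    by (simp add: z_def)
qed simp

text \<open>Convexity of \<open>1 / P\<close> amounts to \<open>P * P'' <= 2 * P'^2\<close>. Up to
  the factor \<open>y\<close>, the difference of the two sides is the Wronskian of \<open>P'\<close>
  and \<open>(y * P)'\<close>. Symmetrising its double sum produces the factors
  \<open>(j - i) * (q (Suc j) * q i - q (Suc i) * q j)\<close>, each nonpositive by
  \<open>log_concave_cross\<close>.\<close>

lemma convex_on_inverse_poly:
  fixes q :: "nat \<Rightarrow> real"
  assumes q: "q 0 = 0" "\<And>j. 1 \<le> j \<Longrightarrow> j \<le> m \<Longrightarrow> 0 < q j" "\<And>j. m < j \<Longrightarrow> q j = 0"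
    and lc: "\<And>j. 2 \<le> j \<Longrightarrow> q (j - 1) * q (j + 1) \<le> (q j)\<^sup>2"
    and m: "1 \<le> m"
  shows "convex_on {0<..} (\<lambda>y. 1 / (\<Sum>j\<le>m. q j * y ^ j))"
proof -
  define P where "P y = (\<Sum>j\<le>m. q j * y ^ j)" for y
  define P1 where "P1 y = (\<Sum>j\<le>m. (real j + 1) * q (Suc j) * y ^ j)" for y
  define P2 where "P2 y = (\<Sum>j\<le>m. (real j + 1) * q (Suc j) * (real j * y ^ (j - 1)))" for y
  have P: "(P has_real_derivative P1 y) (at y)" for y
  proof -
    have "(P has_real_derivative (\<Sum>j\<le>m. q j * (real j * y ^ (j - 1)))) (at y)"
      unfolding P_def by (auto intro!: derivative_eq_intros simp: mult_ac)
    also have "(\<Sum>j\<le>m. q j * (real j * y ^ (j - 1))) = P1 y"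
      unfolding P1_def by (subst sum_shift_0[symmetric]) (auto simp: q(3) mult_ac add_ac)
    finally show ?thesis .
  qed
  have P1: "(P1 has_real_derivative P2 y) (at y)" for y
    unfolding P1_def P2_def by (auto intro!: derivative_eq_intros simp: mult_ac)
  have Ppos: "0 < P y" if "0 < y" for y
  proof -
    have "0 < q 1 * y ^ 1" using q(2)[of 1] m that by simp
    also have "\<dots> \<le> P y"
      unfolding P_def
    proof (rule member_le_sum)
      show "0 \<le> q j * y ^ j" if "j \<in> {..m} - {1}" for j
        using that q(1) q(2)[of j] \<open>0 < y\<close> by (cases "j = 0") auto
    qed (use m in auto)
    finally show ?thesis .
  qed
  have key: "P y * P2 y \<le> 2 * (P1 y)\<^sup>2" if y: "0 < y" for y
  proof -
    \<comment> \<open>\<open>a\<close> and \<open>b\<close> are the coefficients of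
      \<open>P1\<close> and of the derivative of \<open>y * P y\<close>.\<close>
    define a where "a j = (real j + 1) * q (Suc j)" for j
    define b where "b j = (real j + 1) * q j" for j
    define w where "w j i = (real j - real i) * a j * b i * y ^ (i + j)" for i j
    have A: "y * P2 y = (\<Sum>j\<le>m. real j * a j * y ^ j)"
      unfolding P2_def a_def sum_distrib_left
    proof (intro sum.cong refl)
      fix j show "y * ((real j + 1) * q (Suc j) * (real j * y ^ (j - 1))) =
         real j * ((real j + 1) * q (Suc j)) * y ^ j"
        by (cases j) (simp_all add: algebra_simps)
    qed
    have yP1: "y * P1 y = (\<Sum>j\<le>m. real j * q j * y ^ j)"
      unfolding P1_def sum_distrib_left
      using sum_shift_0[of "\<lambda>j. real j * q j * y ^ j" m] by (simp add: q(3) mult_ac add_ac)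
    have yyP2: "y * (y * P2 y) = (\<Sum>j\<le>m. (real j - 1) * real j * q j * y ^ j)"
      unfolding A a_def sum_distrib_left
      using sum_shift_0[of "\<lambda>j. (real j - 1) * real j * q j * y ^ j" m] by (simp add: q(3) mult_ac add_ac)
    have B: "P y + y * P1 y = (\<Sum>j\<le>m. b j * y ^ j)"
      unfolding yP1 P_def b_def by (simp add: sum.distrib[symmetric] algebra_simps)
    have B': "2 * (y * P1 y) + y * (y * P2 y) = (\<Sum>j\<le>m. real j * b j * y ^ j)"
      unfolding yP1 yyP2 b_def sum_distrib_left by (simp add: sum.distrib[symmetric] algebra_simps)
    have P1a: "P1 y = (\<Sum>j\<le>m. a j * y ^ j)" by (simp add: P1_def a_def)
    have "y * (P y * P2 y - 2 * (P1 y)\<^sup>2)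
       = (y * P2 y) * (P y + y * P1 y) - P1 y * (2 * (y * P1 y) + y * (y * P2 y))"
      by (simp add: algebra_simps power2_eq_square)
    also have "\<dots> = (\<Sum>j\<le>m. \<Sum>i\<le>m. w j i)"
    proof -
      have "(\<Sum>j\<le>m. real j * a j * y ^ j) * (\<Sum>j\<le>m. b j * y ^ j)
          - (\<Sum>j\<le>m. a j * y ^ j) * (\<Sum>j\<le>m. real j * b j * y ^ j) = (\<Sum>j\<le>m. \<Sum>i\<le>m. w j i)"
        unfolding sum_product sum_subtractf[symmetric] w_def
        by (intro sum.cong refl) (simp add: algebra_simps power_add)
      then show ?thesis by (simp only: A[symmetric] B[symmetric] B'[symmetric] P1a[symmetric])
    qed
    finally have 1: "y * (P y * P2 y - 2 * (P1 y)\<^sup>2) = (\<Sum>j\<le>m. \<Sum>i\<le>m. w j i)" .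
    have neg: "w j i + w i j \<le> 0" for i j
    proof -
      have "w j i + w i j = ((real j - real i) * (q (Suc j) * q i - q (Suc i) * q j)) * ((real i + 1) * (real j + 1) * y ^ (i + j))"
        by (simp add: w_def a_def b_def algebra_simps)
      also have "\<dots> \<le> 0"
      proof (rule mult_nonpos_nonneg)
        show "(real j - real i) * (q (Suc j) * q i - q (Suc i) * q j) \<le> 0"
        proof (cases "i \<le> j")
          case True
          then show ?thesis using log_concave_cross[OF q lc True]
            by (intro mult_nonneg_nonpos) (auto simp: mult.commute)
        next
          case False
          then have "j \<le> i" by simp
          from log_concave_cross[OF q lc this] this show ?thesis
            by (intro mult_nonpos_nonneg) (auto simp: mult.commute)
        qed
      qed (use y in simp)
      finally show ?thesis .
    qed
    have "2 * (\<Sum>j\<le>m. \<Sum>i\<le>m. w j i) = (\<Sum>j\<le>m. \<Sum>i\<le>m. w j i) + (\<Sum>i\<le>m. \<Sum>j\<le>m. w j i)"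
      using sum.swap[of w "{..m}" "{..m}"] by simp
    also have "\<dots> = (\<Sum>j\<le>m. \<Sum>i\<le>m. w j i + w i j)"
      by (simp add: sum.distrib)
    also have "\<dots> \<le> 0" by (intro sum_nonpos neg)
    finally have "y * (P y * P2 y - 2 * (P1 y)\<^sup>2) \<le> 0" using 1 by simp
    then show ?thesis using y by (simp add: mult_le_0_iff)
  qed
  have "convex_on {0<..} (\<lambda>y. 1 / P y)"
  proof (rule f''_ge0_imp_convex)
    fix y :: real assume "y \<in> {0<..}"
    then have y: "0 < y" "P y > 0" using Ppos by auto
    show "((\<lambda>y. 1 / P y) has_real_derivative - P1 y / (P y)\<^sup>2) (at y)"
      using y by (auto intro!: derivative_eq_intros P simp: power2_eq_square)
    show "((\<lambda>y. - P1 y / (P y)\<^sup>2) has_real_derivative (2 * (P1 y)\<^sup>2 - P y * P2 y) / (P y) ^ 3) (at y)"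
      using y by (auto intro!: derivative_eq_intros P P1 simp: field_simps power2_eq_square power3_eq_cube power4_eq_xxxx)
    show "0 \<le> (2 * (P1 y)\<^sup>2 - P y * P2 y) / (P y) ^ 3"
      using y key[of y] by simp
  qed simp
  then show ?thesis by (simp add: P_def)
qed

text \<open>With \<open>z = 1 + s\<close>, the reciprocal of \<open>gsum\<close> is
  \<open>z / P (1 / z)\<close>, the perspective of the function treated in
  \<open>convex_on_inverse_poly\<close>.\<close>

lemma convex_on_inverse_gsum:
  assumes q: "q 0 = 0" "\<And>j. 1 \<le> j \<Longrightarrow> j \<le> m \<Longrightarrow> 0 < q j" "\<And>j. m < j \<Longrightarrow> q j = 0"
    and lc: "\<And>j. 2 \<le> j \<Longrightarrow> q (j - 1) * q (j + 1) \<le> (q j)\<^sup>2"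
    and m: "1 \<le> m"
  shows "convex_on {0..} (\<lambda>s. 1 / gsum q m s)"
proof (rule convex_onI)
  define h where "h z = z * (1 / (\<Sum>j\<le>m. q j * (1 / z) ^ j))" for z
  have h: "convex_on {0<..} h"
    unfolding h_def by (rule convex_on_perspective[OF convex_on_inverse_poly[OF assms]])
  have g: "1 / gsum q m s = h (1 + s)" if "0 \<le> s" for s
  proof -
    have "gsum q m s = (\<Sum>j\<le>m. q j * (1 / (1 + s)) ^ j) / (1 + s)"
      unfolding gsum_def sum_divide_distrib by (intro sum.cong) (simp_all add: power_one_over field_simps)
    then show ?thesis by (simp add: h_def)
  qed
  fix t x y :: real
  assume t: "0 < t" "t < 1" and xy: "x \<in> {0..}" "y \<in> {0..}"
  have "h ((1 - t) *\<^sub>R (1 + x) + t *\<^sub>R (1 + y)) \<le> (1 - t) * h (1 + x) + t * h (1 + y)"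
    using t xy by (intro convex_onD[OF h]) auto
  moreover have "(1 - t) *\<^sub>R (1 + x) + t *\<^sub>R (1 + y) = 1 + ((1 - t) *\<^sub>R x + t *\<^sub>R y)"
    by (simp add: algebra_simps)
  ultimately show "1 / gsum q m ((1 - t) *\<^sub>R x + t *\<^sub>R y) \<le> (1 - t) * (1 / gsum q m x) + t * (1 / gsum q m y)"
    using g t xy by simp
qed simp

section \<open>Positivity, monotonicity, convexity and decay of the Mittag-Leffler function on the
  negative half-line\<close>

lemma powser_const_0: "(\<Sum>n. 0 ^ n * c n) = (c 0 :: real)"
  using powser_zero[of c] by (simp add: mult.commute)

lemma mittag_leffler_0: "mittag_leffler a 0 = 1"
proof (cases "a = 0")
  case False
  then show ?thesis by (simp add: mittag_leffler_eq powser_const_0 rGamma_inverse_Gamma)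
qed (simp add: mittag_leffler_def)

text \<open>Rules out positive arguments as preimages of values in \<open>(0, 1]\<close>, so that
  \<open>gen_log\<close> is determined there by the negative half-line.\<close>

lemma mittag_leffler_gt_1:
  assumes "0 < a" "0 < x"
  shows "1 < mittag_leffler a x"
proof -
  have pos: "0 < x ^ n * rGamma (1 + a * real n)" for n
    using assms by (simp add: rGamma_inverse_Gamma add_pos_nonneg)
  have "(\<Sum>n<2. x ^ n * rGamma (1 + a * real n)) \<le> mittag_leffler a x"
    using assms unfolding mittag_leffler_eq[OF less_imp_neq[OF assms(1), symmetric]]
    by (intro sum_le_suminf summable_mittag_leffler) (auto intro: less_imp_le[OF pos])
  moreover have "(\<Sum>n<2. x ^ n * rGamma (1 + a * real n)) = 1 + x * rGamma (1 + a)"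
    by (simp add: numeral_eq_Suc rGamma_inverse_Gamma)
  ultimately show ?thesis using pos[of 1] by simp
qed

lemma isCont_mittag_leffler:
  assumes "0 < a"
  shows "isCont (mittag_leffler a) x"
proof -
  have "isCont (\<lambda>x. \<Sum>n. rGamma (1 + a * real n) * x ^ n) x"
    using summable_mittag_leffler[OF assms]
    by (intro isCont_powser_converges_everywhere) (simp add: mult.commute)
  also have "(\<lambda>x. \<Sum>n. rGamma (1 + a * real n) * x ^ n) = mittag_leffler a"
    using assms by (simp add: fun_eq_iff mittag_leffler_eq mult.commute)
  finally show ?thesis .
qed

lemma mittag_leffler_antimono:
  assumes a: "0 < a" "a \<le> 1" and xy: "0 \<le> x" "x \<le> y"
  shows "mittag_leffler a (- y) \<le> mittag_leffler a (- x)"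
proof (rule LIMSEQ_le)
  show "(\<lambda>m. gsum (crp a m) m (x * real m powr (- a))) \<longlonglongrightarrow> mittag_leffler a (- x)"
       "(\<lambda>m. gsum (crp a m) m (y * real m powr (- a))) \<longlonglongrightarrow> mittag_leffler a (- y)"
    using assms by (auto intro!: gsum_crp_LIMSEQ)
  have "gsum (crp a m) m (y * real m powr (- a)) \<le> gsum (crp a m) m (x * real m powr (- a))" for m
    unfolding gsum_def
  proof (intro sum_mono divide_left_mono power_mono)
    show "1 + x * real m powr (- a) \<le> 1 + y * real m powr (- a)"
      using xy by (simp add: mult_right_mono)
    have "0 \<le> x * real m powr (- a)" "0 \<le> y * real m powr (- a)" using xy by simp_all
    then show "0 < (1 + y * real m powr (- a)) ^ (j + 1) * (1 + x * real m powr (- a)) ^ (j + 1)" 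
      "0 \<le> 1 + x * real m powr (- a)" for j
      by (auto intro!: mult_pos_pos zero_less_power)
  qed (use a in \<open>auto intro: crp_nonneg\<close>)
  then show "\<exists>N. \<forall>m\<ge>N. gsum (crp a m) m (y * real m powr (- a)) \<le> gsum (crp a m) m (x * real m powr (- a))"
    by blast
qed

lemma convex_on_inverse_power_Suc: "convex_on {0..} (\<lambda>s::real. 1 / (1 + s) ^ (j + 1))"
proof (rule f''_ge0_imp_convex)
  fix s :: real assume "s \<in> {0..}"
  then have s: "- 1 < s" by simp
  show "((\<lambda>s. 1 / (1 + s) ^ (j + 1)) has_real_derivative - (real j + 1) * (1 / (1 + s) ^ (Suc j + 1))) (at s)"
    using s by (rule DERIV_inverse_power_Suc)
  show "((\<lambda>s. - (real j + 1) * (1 / (1 + s) ^ (Suc j + 1))) has_real_derivative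
      - (real j + 1) * (- (real (Suc j) + 1) * (1 / (1 + s) ^ (Suc (Suc j) + 1)))) (at s)"
    by (intro DERIV_cmult DERIV_inverse_power_Suc s)
  have "0 \<le> (real j + 1) * ((real (Suc j) + 1) * (1 / (1 + s) ^ (Suc (Suc j) + 1)))"
    using s by (intro mult_nonneg_nonneg) auto
  then show "0 \<le> - (real j + 1) * (- (real (Suc j) + 1) * (1 / (1 + s) ^ (Suc (Suc j) + 1)))"
    by (simp only: minus_mult_minus mult_minus_left mult_minus_right minus_minus)
qed simp

lemma convex_on_LIMSEQ:
  fixes f :: "nat \<Rightarrow> 'a::real_vector \<Rightarrow> real"
  assumes "\<forall>\<^sub>F m in sequentially. convex_on A (f m)" "convex A"
    and "\<And>x. x \<in> A \<Longrightarrow> (\<lambda>m. f m x) \<longlonglongrightarrow> g x"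
  shows "convex_on A g"
proof (rule convex_onI)
  fix t x y assume t: "0 < (t::real)" "t < 1" and xy: "x \<in> A" "y \<in> A"
  have z: "(1 - t) *\<^sub>R x + t *\<^sub>R y \<in> A"
    using t xy by (intro convexD[OF assms(2)]) auto
  show "g ((1 - t) *\<^sub>R x + t *\<^sub>R y) \<le> (1 - t) * g x + t * g y"
  proof (rule tendsto_le[OF sequentially_bot])
    show "(\<lambda>m. (1 - t) * f m x + t * f m y) \<longlonglongrightarrow> (1 - t) * g x + t * g y"
      using xy by (intro tendsto_intros assms(3))
    show "(\<lambda>m. f m ((1 - t) *\<^sub>R x + t *\<^sub>R y)) \<longlonglongrightarrow> g ((1 - t) *\<^sub>R x + t *\<^sub>R y)"
      by (rule assms(3)[OF z])
    show "\<forall>\<^sub>F m in sequentially. f m ((1 - t) *\<^sub>R x + t *\<^sub>R y) \<le> (1 - t) * f m x + t * f m y"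
      using assms(1) by eventually_elim (use t xy in \<open>auto intro!: convex_onD\<close>)
  qed
qed (rule assms(2))

lemma convex_on_rescale:
  fixes f :: "real \<Rightarrow> real"
  assumes "convex_on {0..} f" "0 \<le> c"
  shows "convex_on {0..} (\<lambda>s. f (s * c))"
proof (rule convex_onI)
  fix t x y :: real
  assume "0 < t" "t < 1" "x \<in> {0..}" "y \<in> {0..}"
  then have "f ((1 - t) *\<^sub>R (x * c) + t *\<^sub>R (y * c)) \<le> (1 - t) * f (x * c) + t * f (y * c)"
    using assms(2) by (intro convex_onD[OF assms(1)]) auto
  then show "f (((1 - t) *\<^sub>R x + t *\<^sub>R y) * c) \<le> (1 - t) * f (x * c) + t * f (y * c)"
    by (simp add: algebra_simps)
qed simp

text \<open>A limit of nonnegative combinations of convex functions. It serves to make the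
  monotonicity strict below.\<close>

lemma convex_on_mittag_leffler:
  assumes a: "0 < a" "a \<le> 1"
  shows "convex_on {0..} (\<lambda>s. mittag_leffler a (- s))"
proof (rule convex_on_LIMSEQ)
  show "(\<lambda>m. gsum (crp a m) m (s * real m powr (- a))) \<longlonglongrightarrow> mittag_leffler a (- s)" if "s \<in> {0..}" for s
    using that a by (intro gsum_crp_LIMSEQ) auto
  have "convex_on {0..} (gsum (crp a m) m)" for m
  proof -
    have "convex_on {0..} (\<lambda>s. \<Sum>j\<in>J. crp a m j * (1 / (1 + s) ^ (j + 1)))" for J
    proof (induction J rule: infinite_finite_induct)
      case (insert k J)
      have "convex_on {0..} (\<lambda>s. crp a m k * (1 / (1 + s) ^ (k + 1)) + (\<Sum>j\<in>J. crp a m j * (1 / (1 + s) ^ (j + 1))))"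
        using a by (intro convex_on_add convex_on_cmul convex_on_inverse_power_Suc crp_nonneg insert.IH) auto
      then show ?case using insert.hyps by simp
    qed (simp_all add: convex_on_const)
    then show ?thesis by (simp add: gsum_def[abs_def])
  qed
  then show "\<forall>\<^sub>F m in sequentially. convex_on {0..} (\<lambda>s. gsum (crp a m) m (s * real m powr (- a)))"
    by (intro always_eventually allI convex_on_rescale) auto
qed simp

lemma
  assumes a: "0 < a" "a < 1"
  shows mittag_leffler_times_LIM: "((\<lambda>s. s * mittag_leffler a (- s)) \<longlongrightarrow> rGamma (1 - a)) at_top"
    and mittag_leffler_second_order: "((\<lambda>s. s * (s\<^sup>2 * mittag_leffler a (- s) - s * rGamma (1 - a) + rGamma (1 - 2 * a)))
          \<longlongrightarrow> rGamma (1 - 3 * a)) at_top"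
proof -
  define F where "F s = mittag_leffler a (- s)" for s
  obtain C where C: "\<And>s. 0 < s \<Longrightarrow> \<bar>s ^ 3 * F s - (s\<^sup>2 * rGamma (1 - a) - s * rGamma (1 - 2 * a) + rGamma (1 - 3 * a))\<bar> \<le> C / s"
    using mittag_leffler_asymp[OF a] unfolding F_def by blast
  have i: "((\<lambda>s::real. 1 / s) \<longlongrightarrow> 0) at_top"
    using tendsto_inverse_0_at_top[OF filterlim_ident] by (simp add: inverse_eq_divide)
  have Ci: "((\<lambda>s. C / s) \<longlongrightarrow> 0) at_top" using tendsto_mult[OF tendsto_const[of C] i] by simp
  have "((\<lambda>s. s ^ 3 * F s - (s\<^sup>2 * rGamma (1 - a) - s * rGamma (1 - 2 * a) + rGamma (1 - 3 * a))) \<longlongrightarrow> 0) at_top"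
    by (rule Lim_null_comparison[OF _ Ci]) (use C in \<open>auto intro!: eventually_mono[OF eventually_gt_at_top[of 0]]\<close>)
  from tendsto_add[OF this tendsto_const[of "rGamma (1 - 3 * a)"]]
  have 3: "((\<lambda>s. s * (s\<^sup>2 * F s - s * rGamma (1 - a) + rGamma (1 - 2 * a))) \<longlongrightarrow> rGamma (1 - 3 * a)) at_top"
    by (simp add: algebra_simps power2_eq_square power3_eq_cube)
  then show "((\<lambda>s. s * (s\<^sup>2 * mittag_leffler a (- s) - s * rGamma (1 - a) + rGamma (1 - 2 * a)))
          \<longlongrightarrow> rGamma (1 - 3 * a)) at_top" by (simp add: F_def)
  have "((\<lambda>s. ((s * (s\<^sup>2 * F s - s * rGamma (1 - a) + rGamma (1 - 2 * a))) * (1 / s) - rGamma (1 - 2 * a)) * (1 / s) + rGamma (1 - a)) 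
       \<longlongrightarrow> (rGamma (1 - 3 * a) * 0 - rGamma (1 - 2 * a)) * 0 + rGamma (1 - a)) at_top"
    by (intro tendsto_intros 3 i)
  moreover have "\<forall>\<^sub>F s in at_top. ((s * (s\<^sup>2 * F s - s * rGamma (1 - a) + rGamma (1 - 2 * a))) * (1 / s) - rGamma (1 - 2 * a)) * (1 / s) + rGamma (1 - a) = s * F s"
    using eventually_gt_at_top[of "0::real"] by eventually_elim (simp add: field_simps power2_eq_square)
  ultimately show "((\<lambda>s. s * mittag_leffler a (- s)) \<longlongrightarrow> rGamma (1 - a)) at_top"
    by (simp add: tendsto_cong F_def)
qed

text \<open>\<open>s * F s\<close> has the positive limit \<open>rGamma (1 - a)\<close>, so
  \<open>F\<close> is positive far out, and monotonicity carries this back to every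
  \<open>s >= 0\<close>.\<close>

lemma mittag_leffler_pos:
  assumes a: "0 < a" "a < 1" and "0 \<le> s"
  shows "0 < mittag_leffler a (- s)"
proof -
  have r: "0 < rGamma (1 - a)" using a by (simp add: rGamma_inverse_Gamma)
  have "\<forall>\<^sub>F t in at_top. 0 < t * mittag_leffler a (- t)"
    using order_tendstoD(1)[OF mittag_leffler_times_LIM[OF a] r] .
  with eventually_ge_at_top[of "max 1 s"]
  have "\<forall>\<^sub>F t in at_top. max 1 s \<le> t \<and> 0 < t * mittag_leffler a (- t)" by eventually_elim simp
  then obtain t where t: "max 1 s \<le> t" "0 < t * mittag_leffler a (- t)"
    by (metis (mono_tags, lifting) eventually_at_top_linorder order_refl)
  then have "0 < mittag_leffler a (- t)" by (auto simp: zero_less_mult_iff)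
  also have "\<dots> \<le> mittag_leffler a (- s)"
    using t a assms by (intro mittag_leffler_antimono) auto
  finally show ?thesis .
qed

lemma mittag_leffler_LIM_0:
  assumes a: "0 < a" "a < 1"
  shows "((\<lambda>s. mittag_leffler a (- s)) \<longlongrightarrow> 0) at_top"
proof -
  have i: "((\<lambda>s::real. 1 / s) \<longlongrightarrow> 0) at_top"
    using tendsto_inverse_0_at_top[OF filterlim_ident] by (simp add: inverse_eq_divide)
  have "((\<lambda>s. (s * mittag_leffler a (- s)) * (1 / s)) \<longlongrightarrow> rGamma (1 - a) * 0) at_top"
    by (intro tendsto_mult mittag_leffler_times_LIM a i)
  moreover have "\<forall>\<^sub>F s in at_top. (s * mittag_leffler a (- s)) * (1 / s) = mittag_leffler a (- s)"
    using eventually_gt_at_top[of "0::real"] by eventually_elim simp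
  ultimately show ?thesis by (simp add: tendsto_cong)
qed

text \<open>If \<open>F x = F y\<close> with \<open>x < y\<close>, convexity forces
  \<open>F >= F x\<close> beyond \<open>y\<close>, which contradicts positivity and decay to
  0.\<close>

lemma mittag_leffler_strict_antimono:
  assumes a: "0 < a" "a < 1" and xy: "0 \<le> x" "x < y"
  shows "mittag_leffler a (- y) < mittag_leffler a (- x)"
proof (rule ccontr)
  define F where "F s = mittag_leffler a (- s)" for s
  assume "\<not> ?thesis"
  then have eq: "F y = F x"
    unfolding F_def using mittag_leffler_antimono[of a x y] a xy by auto
  have "F x \<le> F z" if "y < z" for z
  proof -
    define t where "t = (y - x) / (z - x)"
    have t: "0 < t" "t < 1" using xy that by (auto simp: t_def)
    have "t * (z - x) = y - x" using xy that by (simp add: t_def)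
    then have "(1 - t) *\<^sub>R x + t *\<^sub>R z = y" by (simp add: algebra_simps)
    moreover have "F ((1 - t) *\<^sub>R x + t *\<^sub>R z) \<le> (1 - t) * F x + t * F z"
      unfolding F_def using a xy that t by (intro convex_onD[OF convex_on_mittag_leffler]) auto
    ultimately have "t * F x \<le> t * F z" by (simp add: eq algebra_simps)
    then show ?thesis using t by simp
  qed
  then have "\<forall>\<^sub>F z in at_top. F x \<le> F z"
    by (rule eventually_mono[OF eventually_gt_at_top[of y]])
  then have "F x \<le> 0"
    using mittag_leffler_LIM_0[OF a] unfolding F_def
    by (intro tendsto_lowerbound[where F = at_top]) auto
  then show False using mittag_leffler_pos[OF a, of x] xy by (simp add: F_def)
qed

text \<open>Replacing the entry at 0 by 0 makes the log-concavity condition at index 1 trivial and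
  leaves those at \<open>j >= 2\<close> unchanged. The discarded mass is of order
  \<open>m powr (- a)\<close>, so the limit stays the same.\<close>

lemma convex_on_inverse_mittag_leffler:
  assumes a: "0 < a" "a < 1"
    and lc: "\<forall>\<^sub>F m in sequentially. \<forall>j\<ge>2. crp a m (j - 1) * crp a m (j + 1) \<le> (crp a m j)\<^sup>2"
  shows "convex_on {0..} (\<lambda>s. 1 / mittag_leffler a (- s))"
proof (rule convex_on_LIMSEQ)
  define q where "q m = (crp a m)(0 := 0)" for m
  have g: "gsum (q m) m s = gsum (crp a m) m s - crp a m 0 * (1 / (1 + s))" for m s
  proof -
    have "gsum (crp a m) m s - gsum (q m) m s = (\<Sum>j\<le>m. if j = 0 then crp a m 0 / (1 + s) else 0)"
      unfolding gsum_def sum_subtractf[symmetric] by (intro sum.cong) (auto simp: q_def)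
    then show ?thesis by simp
  qed
  show "\<forall>\<^sub>F m in sequentially. convex_on {0..} (\<lambda>s. 1 / gsum (q m) m (s * real m powr (- a)))"
    using lc eventually_ge_at_top[of 1]
  proof eventually_elim
    case (elim m)
    have "convex_on {0..} (\<lambda>s. 1 / gsum (q m) m s)"
    proof (rule convex_on_inverse_gsum)
      show "q m (j - 1) * q m (j + 1) \<le> (q m j)\<^sup>2" if "2 \<le> j" for j
        using that elim(1) by (auto simp: q_def)
    qed (use elim crp_pos[OF a] crp_eq_0 in \<open>auto simp: q_def\<close>)
    then show ?case by (rule convex_on_rescale) simp
  qed
  have u: "(\<lambda>m. real m powr (- a)) \<longlonglongrightarrow> 0"
    using a by (intro tendsto_neg_powr filterlim_real_sequentially) auto
  have c: "(\<lambda>m. crp a m 0) \<longlonglongrightarrow> 0"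
  proof -
    have "(\<lambda>m. (pochhammer (1 - a) m / fact m * real m powr (1 - (1 - a))) * real m powr (- a)) \<longlonglongrightarrow> rGamma (1 - a) * 0"
      by (intro tendsto_mult pochhammer_asymp u)
    moreover have "\<forall>\<^sub>F m in sequentially. (pochhammer (1 - a) m / fact m * real m powr (1 - (1 - a))) * real m powr (- a) = crp a m 0"
      using eventually_gt_at_top[of "0::nat"]
      by eventually_elim (use fdiff_crp_at_0[of 0 a] in \<open>simp add: powr_minus\<close>)
    ultimately show ?thesis by (simp add: tendsto_cong)
  qed
  show "(\<lambda>m. 1 / gsum (q m) m (s * real m powr (- a))) \<longlonglongrightarrow> 1 / mittag_leffler a (- s)" if s: "s \<in> {0..}" for s
  proof -
    have "(\<lambda>m. gsum (crp a m) m (s * real m powr (- a)) - crp a m 0 * (1 / (1 + s * real m powr (- a))))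
        \<longlonglongrightarrow> mittag_leffler a (- s) - 0 * (1 / (1 + s * 0))"
      using s a by (intro tendsto_intros gsum_crp_LIMSEQ u c) auto
    then show ?thesis
      unfolding g using mittag_leffler_pos[OF a, of s] s by (intro tendsto_intros) auto
  qed
qed simp

subsection \<open>Concavity on the unit interval and convexity of the reciprocal\<close>

text \<open>Perspective argument in the parametrisation \<open>x = F s\<close>,
  \<open>h x = s * F s\<close>. The end point 0 corresponds to \<open>s\<close> at infinity and is
  treated by a limit.\<close>

lemma concave_on_of_convex_on_inverse:
  fixes F h :: "real \<Rightarrow> real"
  assumes anti: "\<And>s t. 0 \<le> s \<Longrightarrow> s < t \<Longrightarrow> F t < F s"
    and pos: "\<And>s. 0 \<le> s \<Longrightarrow> 0 < F s"
    and surj: "\<And>x. 0 < x \<Longrightarrow> x \<le> 1 \<Longrightarrow> \<exists>s\<ge>0. F s = x"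
    and conv: "convex_on {0..} (\<lambda>s. 1 / F s)"
    and lim: "((\<lambda>s. s * F s) \<longlongrightarrow> c) at_top"
    and h: "h 0 = c" "\<And>s. 0 \<le> s \<Longrightarrow> h (F s) = s * F s"
  shows "concave_on {0..1} h"
proof -
  \<comment> \<open>Convexity of \<open>1 / F\<close> at \<open>r < w < s\<close>, multiplied by
    \<open>F s\<close>, has a limit as \<open>s\<close> tends to infinity because \<open>F s\<close>
    tends to 0 and \<open>s * F s\<close> to \<open>c\<close>.\<close>
  have zero: "(1 - t) * c + t * h y \<le> h (t * y)" if t: "0 < t" "t < 1" and y: "0 < y" "y \<le> 1" for t y
  proof -
    obtain r where r: "0 \<le> r" "F r = y" using surj[OF y] by blast
    have ty: "t * y < y" "0 < t * y" "t * y \<le> 1"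
      using t y mult_mono[of t 1 y 1] by auto
    then obtain w where w: "0 \<le> w" "F w = t * y" using surj[of "t * y"] by blast
    have rw: "r < w"
    proof (rule ccontr)
      assume "\<not> r < w"
      then have "F r \<le> F w" using anti[of w r] w(1) by (cases "r = w") auto
      then show False using r w ty by linarith
    qed
    have "(1 - t) / (t * y) * (s * F s - r * F s) \<le> (1 - F s * (1 / y)) * (w - r)" if s: "w < s" for s
    proof -
      define l where "l = (w - r) / (s - r)"
      have l: "0 < l" "l < 1" "l * (s - r) = w - r" using rw s by (auto simp: l_def)
      have Fs: "0 < F s" using s w by (intro pos) simp
      have "1 / F ((1 - l) *\<^sub>R r + l *\<^sub>R s) \<le> (1 - l) * (1 / F r) + l * (1 / F s)"
        using l r s w by (intro convex_onD[OF conv]) auto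
      moreover have "(1 - l) *\<^sub>R r + l *\<^sub>R s = w" using l(3) by (simp add: algebra_simps)
      ultimately have "1 / (t * y) - 1 / y \<le> l * (1 / F s - 1 / y)"
        using r w by (simp add: algebra_simps diff_divide_distrib)
      then have "(s - r) * (1 / (t * y) - 1 / y) \<le> (s - r) * (l * (1 / F s - 1 / y))"
        using rw s by (intro mult_left_mono) auto
      also have "\<dots> = (w - r) * (1 / F s - 1 / y)" using l(3) by (metis mult.assoc mult.commute)
      finally have "F s * ((s - r) * (1 / (t * y) - 1 / y)) \<le> F s * ((w - r) * (1 / F s - 1 / y))"
        using Fs by (intro mult_left_mono) auto
      moreover have "1 / (t * y) - 1 / y = (1 - t) / (t * y)" using t y by (simp add: field_simps)
      moreover have "F s * ((s - r) * k) = k * (s * F s - r * F s)" for k by (simp add: algebra_simps)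
      moreover have "F s * ((w - r) * (1 / F s - 1 / y)) = (1 - F s * (1 / y)) * (w - r)"
      proof -
        have "F s * ((w - r) * (1 / F s - 1 / y)) = (w - r) * (F s * (1 / F s) - F s * (1 / y))"
          by (simp only: right_diff_distrib mult_ac)
        then show ?thesis using Fs by simp
      qed
      ultimately show ?thesis by simp
    qed
    then have ev: "\<forall>\<^sub>F s in at_top. (1 - t) / (t * y) * (s * F s - r * F s) \<le> (1 - F s * (1 / y)) * (w - r)"
      by (rule eventually_mono[OF eventually_gt_at_top[of w]])
    have F0: "(F \<longlongrightarrow> 0) at_top"
    proof -
      have "((\<lambda>s. (s * F s) * inverse s) \<longlongrightarrow> c * 0) at_top"
        by (intro tendsto_mult lim tendsto_inverse_0_at_top filterlim_ident)
      moreover have "\<forall>\<^sub>F s in at_top. (s * F s) * inverse s = F s"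
        using eventually_gt_at_top[of "0::real"] by eventually_elim simp
      ultimately show ?thesis by (simp add: tendsto_cong)
    qed
    have "(1 - t) / (t * y) * (c - r * 0) \<le> (1 - 0 * (1 / y)) * (w - r)"
      by (rule tendsto_le[OF trivial_limit_at_top_linorder _ _ ev]) (intro tendsto_intros lim F0)+
    then have "(1 - t) * c \<le> (w - r) * (t * y)"
      using ty(2) by (simp add: pos_divide_le_eq del: divide_le_0_iff)
    then show ?thesis using h(2)[OF r(1)] h(2)[OF w(1)] r w by (simp add: algebra_simps)
  qed
  show ?thesis
    unfolding concave_on_def
  proof (rule convex_onI)
    fix t x y :: real
    assume t: "0 < t" "t < 1" and xy: "x \<in> {0..1}" "y \<in> {0..1}"
    consider "x = 0" "y = 0" | "x = 0" "0 < y" | "0 < x" "y = 0" | "0 < x" "0 < y"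
      using xy by fastforce
    then have "(1 - t) * h x + t * h y \<le> h ((1 - t) * x + t * y)"
    proof cases
      case 2
      then show ?thesis using zero[of t y] t xy h by simp
    next
      case 3
      then show ?thesis using zero[of "1 - t" x] t xy h by simp
    next
      case 4
      obtain p where p: "0 \<le> p" "F p = x" using surj[of x] 4 xy by auto
      obtain r where r: "0 \<le> r" "F r = y" using surj[of y] 4 xy by auto
      define z where "z = (1 - t) * x + t * y"
      have z: "0 < z" "z \<le> 1"
        using t xy 4 convex_bound_le[of x 1 y "1 - t" t] by (auto simp: z_def add_pos_pos)
      obtain w where w: "0 \<le> w" "F w = z" using surj[OF z] by blast
      \<comment> \<open>With this weight the chord of \<open>1 / F\<close> from \<open>p\<close> to
        \<open>r\<close> has height \<open>1 / z\<close> at \<open>v\<close>, so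
        \<open>F v >= z = F w\<close> and hence \<open>v <= w\<close>.\<close>
      define l where "l = t * y / z"
      have l: "0 \<le> l" "l \<le> 1" "1 - l = (1 - t) * x / z"
        using t 4 z by (simp_all add: l_def field_simps) (simp_all add: z_def algebra_simps)
      define v where "v = (1 - l) * p + l * r"
      have v: "0 \<le> v"
        unfolding v_def using l(1,2) p(1) r(1) by (intro add_nonneg_nonneg mult_nonneg_nonneg) auto
      have "1 / F ((1 - l) *\<^sub>R p + l *\<^sub>R r) \<le> (1 - l) * (1 / F p) + l * (1 / F r)"
        using l p r by (intro convex_onD[OF conv]) auto
      also have "\<dots> = 1 / z"
        using 4 z unfolding l(3) unfolding l_def p r by (simp add: add_divide_distrib[symmetric])
      finally have "F w \<le> F v"
        using pos[OF v] z w by (simp add: v_def field_simps)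
      then have "v \<le> w" using anti[of w v] w by force
      then have "z * v \<le> z * w" using z by simp
      moreover have "z * v = (1 - t) * x * p + t * y * r"
        using z unfolding v_def l(3) unfolding l_def by (simp add: field_simps)
      ultimately show ?thesis using h(2)[OF p(1)] h(2)[OF r(1)] h(2)[OF w(1)] p r w
        by (simp add: z_def mult_ac)
    qed (use t h in \<open>simp add: algebra_simps\<close>)
    then show "- h ((1 - t) *\<^sub>R x + t *\<^sub>R y) \<le> (1 - t) * - h x + t * - h y"
      by (simp add: algebra_simps)
  qed simp
qed

text \<open>The reverse passage, where the weights are chosen so that the mixed point is a harmonic
  mean.\<close>

lemma convex_on_inverse_of_concave_on:
  fixes F h :: "real \<Rightarrow> real"
  assumes anti: "\<And>s t. 0 \<le> s \<Longrightarrow> s < t \<Longrightarrow> F t < F s"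
    and bounds: "\<And>s. 0 \<le> s \<Longrightarrow> 0 < F s" "\<And>s. 0 \<le> s \<Longrightarrow> F s \<le> 1"
    and surj: "\<And>x. 0 < x \<Longrightarrow> x \<le> 1 \<Longrightarrow> \<exists>s\<ge>0. F s = x"
    and h: "\<And>s. 0 \<le> s \<Longrightarrow> h (F s) = s * F s"
    and conc: "concave_on {0..1} h"
  shows "convex_on {0..} (\<lambda>s. 1 / F s)"
proof (rule convex_onI)
  fix t p r :: real
  assume t: "0 < t" "t < 1" and "p \<in> {0..}" "r \<in> {0..}"
  then have pr: "0 \<le> p" "0 \<le> r" by auto
  define x y where "x = F p" and "y = F r"
  have xy: "0 < x" "x \<le> 1" "0 < y" "y \<le> 1" using bounds pr by (auto simp: x_def y_def)
  define z where "z = (1 - t) / x + t / y"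
  have z: "0 < z" using t xy by (simp add: z_def add_pos_pos)
  \<comment> \<open>This makes \<open>(1 - l) * x + l * y\<close> equal to \<open>1 / z\<close> and
    turns \<open>(1 - l) * h x + l * h y\<close> into
    \<open>((1 - t) * p + t * r) / z\<close>.\<close>
  define l where "l = t / (y * z)"
  have l: "0 \<le> l" "1 - l = (1 - t) / (x * z)"
    using t xy z by (simp_all add: l_def field_simps) (simp_all add: z_def field_simps)
  have "0 \<le> 1 - l" unfolding l(2) using t xy z by simp
  then have l1: "l \<le> 1" by simp
  have comb: "(1 - l) * x + l * y = 1 / z"
    unfolding l(2) unfolding l_def using xy z by (simp add: add_divide_distrib[symmetric])
  have z1: "1 / z \<le> 1"
    unfolding comb[symmetric] using convex_bound_le[of x 1 y "1 - l" l] l l1 xy by auto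
  obtain w where w: "0 \<le> w" "F w = 1 / z" using surj[of "1 / z"] z z1 by auto
  define v where "v = (1 - t) * p + t * r"
  have v: "0 \<le> v" using t pr by (simp add: v_def)
  have "(1 - l) * h x + l * h y \<le> h ((1 - l) *\<^sub>R x + l *\<^sub>R y)"
    using l l1 xy by (intro concave_onD[OF conc]) auto
  also have "\<dots> = w / z" using h[OF w(1)] comb w by simp
  also have "(1 - l) * h x + l * h y = v / z"
    unfolding l(2) unfolding l_def v_def using h[OF pr(1)] h[OF pr(2)] xy z
    by (simp add: x_def[symmetric] y_def[symmetric] add_divide_distrib)
  finally have "v \<le> w" using z by (simp add: divide_le_cancel)
  then have "F w \<le> F v" using anti[OF v, of w] by (cases "v = w") auto
  then have "1 / F v \<le> z" using w z bounds(1)[OF v] by (simp add: field_simps)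
  then show "1 / F ((1 - t) *\<^sub>R p + t *\<^sub>R r) \<le> (1 - t) * (1 / F p) + t * (1 / F r)"
    by (simp add: v_def z_def x_def y_def)
qed simp

text \<open>Let \<open>D\<close> be the difference of \<open>1 / F\<close> and its asymptote
  \<open>L\<close>. If \<open>1 / F\<close> is convex, so is \<open>D\<close>. But \<open>D\<close>
  is eventually negative and tends to 0, so it rises somewhere from a negative value, and convexity
  would then push it above 0.\<close>

lemma not_convex_on_inverse_mittag_leffler:
  assumes a: "0 < a" "a < 1"
    and less: "(rGamma (1 - 2 * a))\<^sup>2 < rGamma (1 - a) * rGamma (1 - 3 * a)"
  shows "\<not> convex_on {0..} (\<lambda>s. 1 / mittag_leffler a (- s))"
proof
  define F where "F s = mittag_leffler a (- s)" for s
  define a1 a2 a3 where "a1 = rGamma (1 - a)" and "a2 = rGamma (1 - 2 * a)" and "a3 = rGamma (1 - 3 * a)"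
  have a1: "0 < a1" using a by (simp add: a1_def rGamma_inverse_Gamma)
  assume "convex_on {0..} (\<lambda>s. 1 / mittag_leffler a (- s))"
  then have conv: "convex_on {0..} (\<lambda>s. 1 / F s)" by (simp add: F_def)
  define L where "L s = s / a1 + a2 / a1\<^sup>2" for s
  define D where "D s = 1 / F s - L s" for s
  define R where "R s = s\<^sup>2 * F s - s * a1 + a2" for s
  have i: "((\<lambda>s::real. 1 / s) \<longlongrightarrow> 0) at_top"
    using tendsto_inverse_0_at_top[OF filterlim_ident] by (simp add: inverse_eq_divide)
  have sR: "((\<lambda>s. s * R s) \<longlongrightarrow> a3) at_top"
    using mittag_leffler_second_order[OF a] by (simp add: R_def F_def a1_def a2_def a3_def)
  have sF: "((\<lambda>s. s * F s) \<longlongrightarrow> a1) at_top"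
    using mittag_leffler_times_LIM[OF a] by (simp add: F_def a1_def)
  \<comment> \<open>\<open>s * D s\<close> tends to \<open>k / a1\<close>; the strict hypothesis
    makes \<open>k\<close> negative.\<close>
  define k where "k = a2\<^sup>2 / a1\<^sup>2 - a3 / a1"
  have k: "k < 0"
    using less[folded a1_def a2_def a3_def] a1 by (simp add: k_def field_simps power2_eq_square)
  define Q where "Q s = a2\<^sup>2 / a1\<^sup>2 - s * R s / a1 - (s * R s) * (1 / s) * a2 / a1\<^sup>2" for s
  have Q: "(Q \<longlongrightarrow> k) at_top"
  proof -
    have "(Q \<longlongrightarrow> a2\<^sup>2 / a1\<^sup>2 - a3 / a1 - a3 * 0 * a2 / a1\<^sup>2) at_top"
      unfolding Q_def using a1 by (intro tendsto_intros sR i) auto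
    then show ?thesis by (simp add: k_def)
  qed
  have DQ: "D s = Q s * (1 / s) / (s * F s)" if s: "0 < s" for s
  proof -
    have F: "0 < F s" unfolding F_def using mittag_leffler_pos[OF a] s by simp
    have "Q s = s\<^sup>2 * (1 - F s * L s)"
      using s a1 by (simp add: Q_def R_def L_def field_simps power2_eq_square)
    then have "Q s * (1 / s) / (s * F s) = (1 - F s * L s) / F s"
      using s F by (simp add: power2_eq_square)
    then show ?thesis using F by (simp add: D_def diff_divide_distrib)
  qed
  have "((\<lambda>s. Q s * (1 / s) / (s * F s)) \<longlongrightarrow> k * 0 / a1) at_top"
    using a1 by (intro tendsto_intros Q i sF) auto
  moreover have "\<forall>\<^sub>F s in at_top. Q s * (1 / s) / (s * F s) = D s"
    by (rule eventually_mono[OF eventually_gt_at_top[of 0]]) (simp add: DQ)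
  ultimately have D0: "(D \<longlongrightarrow> 0) at_top" by (simp add: tendsto_cong)
  have "\<forall>\<^sub>F s in at_top. D s < 0"
    using order_tendstoD(2)[OF Q k] eventually_gt_at_top[of "0::real"]
  proof eventually_elim
    case (elim s)
    moreover have "0 < F s" unfolding F_def using mittag_leffler_pos[OF a] elim by simp
    ultimately show ?case by (simp add: DQ divide_neg_pos)
  qed
  then obtain s0 where s0: "\<And>s. s0 \<le> s \<Longrightarrow> D s < 0"
    by (auto simp: eventually_at_top_linorder)
  define s1 where "s1 = max 0 s0"
  have s1: "D s1 < 0" using s0[of s1] by (simp add: s1_def)
  have "\<forall>\<^sub>F s in at_top. D s1 < D s \<and> s1 < s"
    using order_tendstoD(1)[OF D0 s1] eventually_gt_at_top[of s1] by eventually_elim simp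
  then obtain s2 where s2: "D s1 < D s2" "s1 < s2"
    by (auto simp: eventually_at_top_linorder)
  \<comment> \<open>Lies beyond the zero of the line through the points of \<open>D\<close> at
    \<open>s1\<close> and \<open>s2\<close>, where convexity contradicts
    \<open>D s < 0\<close>.\<close>
  define s where "s = max (s2 + 1) (s1 + (s2 - s1) * (- D s1) / (D s2 - D s1) + 1)"
  have s: "s2 < s" by (simp add: s_def)
  define t where "t = (s2 - s1) / (s - s1)"
  have t: "0 < t" "t < 1" "t * (s - s1) = s2 - s1" using s s2 by (auto simp: t_def)
  have "1 / F ((1 - t) *\<^sub>R s1 + t *\<^sub>R s) \<le> (1 - t) * (1 / F s1) + t * (1 / F s)"
    using t s s2 by (intro convex_onD[OF conv]) (auto simp: s1_def)
  moreover have e: "(1 - t) *\<^sub>R s1 + t *\<^sub>R s = s2" using t(3) by (simp add: algebra_simps)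
  moreover have "L s2 = (1 - t) * L s1 + t * L s"
    unfolding e[symmetric] L_def using a1 by (simp add: field_simps)
  ultimately have "D s2 \<le> (1 - t) * D s1 + t * D s" by (simp add: D_def algebra_simps)
  moreover have "t * D s < 0" using s0[of s] s s2 t by (simp add: s1_def mult_pos_neg)
  ultimately have "D s2 - D s1 < t * (- D s1)" by (simp add: algebra_simps)
  then have "(s - s1) * (D s2 - D s1) < (s - s1) * (t * (- D s1))"
    using s s2 by (intro mult_strict_left_mono) auto
  also have "\<dots> = (s2 - s1) * (- D s1)" using t(3) by (metis mult.assoc mult.commute)
  finally have "s - s1 < (s2 - s1) * (- D s1) / (D s2 - D s1)"
    using s2(1) by (simp only: pos_less_divide_eq diff_gt_0_iff_gt)
  then show False by (simp add: s_def)
qed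

subsection \<open>Log-concavity of the recursion\<close>

text \<open>Here \<open>p0\<close>, ..., \<open>p3\<close> are the old entries at
  \<open>j - 2\<close>, ..., \<open>j + 1\<close>, and \<open>A\<close>, \<open>B\<close> the
  coefficients at \<open>j\<close>; at the neighbouring indices these shift by \<open>a\<close>. The
  new discriminant thus splits into old ones, a cross term and a square.\<close>

lemma crp_log_concave_identity:
  fixes A B a p0 p1 p2 p3 :: real
  shows "(A * p2 + B * p1)\<^sup>2 - ((A + a) * p1 + (B - a) * p0) * ((A - a) * p3 + (B + a) * p2)
    = (A + a) * (A - a) * (p2\<^sup>2 - p1 * p3) + (B - a) * (B + a) * (p1\<^sup>2 - p0 * p2)
      + (A - a) * (B - a) * (p2 * p1 - p0 * p3) + a\<^sup>2 * (p2 - p1)\<^sup>2"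
  by (simp add: algebra_simps power2_eq_square)

definition crp_disc :: "real \<Rightarrow> nat \<Rightarrow> nat \<Rightarrow> real" where
  "crp_disc a m j = (crp a m j)\<^sup>2 - crp a m (j - 1) * crp a m (j + 1)"

text \<open>At \<open>j = 1\<close> the truncated indices \<open>j - 2\<close> and
  \<open>(j - 1) - 1\<close> are harmless, because both terms containing them carry the factor
  \<open>real j - 1\<close>.\<close>

lemma crp_disc_Suc:
  assumes "1 \<le> j"
  shows "(real (Suc m))\<^sup>2 * crp_disc a (Suc m) j =
     (real (Suc m) - a * real j) * (real (Suc m) - a * (real j + 2)) * crp_disc a m j
     + a\<^sup>2 * (real j - 1) * (real j + 1) * crp_disc a m (j - 1)
     + (real (Suc m) - a * (real j + 2)) * (a * (real j - 1)) * (crp a m j * crp a m (j - 1) - crp a m (j - 2) * crp a m (j + 1))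
     + a\<^sup>2 * (crp a m j - crp a m (j - 1))\<^sup>2"
proof -
  obtain i where i: "j = Suc i" using assms by (cases j) auto
  define n where "n = real (Suc m)"
  define A where "A = n - a * (real j + 1)"
  define B where "B = a * real j"
  have n: "n \<noteq> 0" by (simp add: n_def)
  have S: "n * crp a (Suc m) k = (n - a * (real k + 1)) * crp a m k + a * real k * crp a m (k - 1)" for k
    by (simp add: n_def)
  have "n\<^sup>2 * crp_disc a (Suc m) j = (n * crp a (Suc m) j)\<^sup>2 - (n * crp a (Suc m) (j - 1)) * (n * crp a (Suc m) (j + 1))"
    by (simp add: crp_disc_def algebra_simps power2_eq_square del: crp.simps)
  also have "\<dots> = (A * crp a m j + B * crp a m (j - 1))\<^sup>2
      - ((A + a) * crp a m (j - 1) + (B - a) * crp a m (j - 2)) * ((A - a) * crp a m (j + 1) + (B + a) * crp a m j)"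
    unfolding S by (simp add: A_def B_def i algebra_simps)
  also have "\<dots> = (A + a) * (A - a) * crp_disc a m j + (B - a) * (B + a) * crp_disc a m (j - 1)
      + (A - a) * (B - a) * (crp a m j * crp a m (j - 1) - crp a m (j - 2) * crp a m (j + 1)) + a\<^sup>2 * (crp a m j - crp a m (j - 1))\<^sup>2"
    unfolding crp_log_concave_identity by (simp add: crp_disc_def i)
  finally show ?thesis
    by (simp add: n_def A_def B_def algebra_simps power2_eq_square del: of_nat_Suc)
qed

text \<open>Multiply the log-concavity inequalities at \<open>j - 1\<close> and \<open>j\<close>,
  then cancel the positive product of the two middle entries.\<close>

lemma crp_disc_nonneg_cross:
  assumes a: "0 < a" "a < 1" and j: "2 \<le> j" and D: "0 \<le> crp_disc a m j" "0 \<le> crp_disc a m (j - 1)"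
  shows "crp a m (j - 2) * crp a m (j + 1) \<le> crp a m j * crp a m (j - 1)"
proof (cases "j \<le> m")
  case False
  then show ?thesis using crp_nonneg[of a m] a by (simp add: crp_eq_0)
next
  case True
  define p where "p k = crp a m k" for k
  have pos: "0 < p k" if "k \<le> m" for k using crp_pos[OF a that] by (simp add: p_def)
  have nonneg: "0 \<le> p k" for k using crp_nonneg[of a m k] a by (simp add: p_def)
  have D': "p (j - 1) * p (j + 1) \<le> (p j)\<^sup>2" "p (j - 2) * p j \<le> (p (j - 1))\<^sup>2"
    using D j by (auto simp: crp_disc_def p_def numeral_2_eq_2)
  have "(p (j - 1) * p j) * (p (j - 2) * p (j + 1)) = (p (j - 1) * p (j + 1)) * (p (j - 2) * p j)"
    by simp
  also have "\<dots> \<le> (p j)\<^sup>2 * (p (j - 1))\<^sup>2"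
    by (intro mult_mono D') (auto intro!: mult_nonneg_nonneg nonneg)
  also have "\<dots> = (p (j - 1) * p j) * (p j * p (j - 1))" by (simp add: power2_eq_square)
  finally show ?thesis
    using pos[of j] pos[of "j - 1"] True by (simp add: p_def)
qed

text \<open>The condition \<open>a * (m + 2) \<le> m + 1\<close> keeps every coefficient of the recursion nonnegative
  up to the index one past the support.\<close>
lemma crp_disc_nonneg_step:
  assumes a: "0 < a" "a < 1" and j: "1 \<le> j" and m: "a * (real m + 2) \<le> real m + 1"
    and D: "0 \<le> crp_disc a m j" "2 \<le> j \<Longrightarrow> 0 \<le> crp_disc a m (j - 1)"
  shows "0 \<le> crp_disc a (Suc m) j"
proof (cases "j \<le> m")
  case False
  then show ?thesis by (simp add: crp_disc_def crp_eq_0)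
next
  case True
  have "a * (real j + 2) \<le> a * (real m + 2)" using True a by (intro mult_left_mono) auto
  then have c: "a * (real j + 2) \<le> real (Suc m)" using m by simp
  moreover have "a * real j \<le> a * (real j + 2)" using a by (intro mult_left_mono) auto
  ultimately have c': "a * real j \<le> real (Suc m)" by simp
  have "0 \<le> (real (Suc m))\<^sup>2 * crp_disc a (Suc m) j"
  proof (cases "j = 1")
    case True
    then show ?thesis
      unfolding crp_disc_Suc[OF j] using c c' a D(1) by simp
  next
    case False
    then have j2: "2 \<le> j" using j by simp
    show ?thesis
      unfolding crp_disc_Suc[OF j] using c c' j a D(1) D(2)[OF j2] crp_disc_nonneg_cross[OF a j2 D(1) D(2)[OF j2]]
      by (intro add_nonneg_nonneg mult_nonneg_nonneg) auto
  qed
  then show ?thesis by (simp add: zero_le_mult_iff del: of_nat_Suc)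
qed

text \<open>The threshold \<open>5/7\<close> is where the discriminant of row 2 at index 1 changes
  sign. Below it, log-concavity from index 1 on is inherited by all later rows.\<close>

lemma crp_disc_nonneg_small:
  assumes a: "0 < a" "a \<le> 5/7" and m: "2 \<le> m" and j: "1 \<le> j"
  shows "0 \<le> crp_disc a m j"
  using m j
proof (induction m arbitrary: j rule: dec_induct)
  case base
  show ?case
  proof (cases "j = 1")
    case True
    have "crp_disc a 2 1 = a\<^sup>2 * (1 - a) * (5 - 7 * a) / 4"
      unfolding crp_disc_def by (simp add: numeral_2_eq_2 field_simps power2_eq_square)
    moreover have "0 \<le> a\<^sup>2 * (1 - a) * (5 - 7 * a) / 4" using a by simp
    ultimately show ?thesis by (simp only: True)
  next
    case False
    then show ?thesis using base by (simp add: crp_disc_def crp_eq_0)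
  qed
next
  case (step m)
  have "a * (real m + 2) \<le> 5/7 * (real m + 2)" using a by (intro mult_right_mono) auto
  also have "\<dots> \<le> real m + 1" using step by simp
  finally show ?case using a step by (intro crp_disc_nonneg_step) auto
qed

section \<open>The explicit base case in row 7\<close>

lemma crp_rec:
  "0 < m \<Longrightarrow> crp a m j = ((real m - a * (real j + 1)) * crp a (m - 1) j + a * real j * crp a (m - 1) (j - 1)) / real m"
  by (cases m) auto

text \<open>Row 7 over the common denominator \<open>7! = 5040\<close>, built row by row. The entry
  at 0 is omitted because discriminants at indices \<open>j >= 2\<close> do not contain it.\<close>

lemma crp_7:
  shows "crp a 7 1 = (13068 * a - 39396 * a ^ 2 + 47383 * a ^ 3 - 29400 * a ^ 4 + 9982 * a ^ 5 - 1764 * a ^ 6 + 127 * a ^ 7) / 5040"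
   and "crp a 7 2 = (26264 * a ^ 2 - 81228 * a ^ 3 + 98000 * a ^ 4 - 57960 * a ^ 5 + 16856 * a ^ 6 - 1932 * a ^ 7) / 5040"
   and "crp a 7 3 = (40614 * a ^ 3 - 117600 * a ^ 4 + 125580 * a ^ 5 - 58800 * a ^ 6 + 10206 * a ^ 7) / 5040"
   and "crp a 7 4 = (47040 * a ^ 4 - 115920 * a ^ 5 + 94080 * a ^ 6 - 25200 * a ^ 7) / 5040"
   and "crp a 7 5 = (38640 * a ^ 5 - 70560 * a ^ 6 + 31920 * a ^ 7) / 5040"
   and "crp a 7 6 = (20160 * a ^ 6 - 20160 * a ^ 7) / 5040"
   and "crp a 7 7 = (5040 * a ^ 7) / 5040"
proof -
  have r1: "crp a 1 0 = (1 - 1 * a) / 1"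
    "crp a 1 1 = (1 * a) / 1"
    by (simp_all add: crp_rec[of 1] field_simps power_numeral_reduce del: One_nat_def)
  have r2: "crp a 2 0 = (2 - 3 * a + 1 * a ^ 2) / 2"
    "crp a 2 1 = (3 * a - 3 * a ^ 2) / 2"
    "crp a 2 2 = (2 * a ^ 2) / 2"
    by (simp_all add: crp_rec[of 2] crp_eq_0 r1[unfolded One_nat_def] field_simps power_numeral_reduce)
  have r3: "crp a 3 0 = (6 - 11 * a + 6 * a ^ 2 - 1 * a ^ 3) / 6"
    "crp a 3 1 = (11 * a - 18 * a ^ 2 + 7 * a ^ 3) / 6"
    "crp a 3 2 = (12 * a ^ 2 - 12 * a ^ 3) / 6"
    "crp a 3 3 = (6 * a ^ 3) / 6"
    by (simp_all add: crp_rec[of 3] crp_eq_0 r2[unfolded One_nat_def] field_simps power_numeral_reduce)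
  have r4: "crp a 4 0 = (24 - 50 * a + 35 * a ^ 2 - 10 * a ^ 3 + 1 * a ^ 4) / 24"
    "crp a 4 1 = (50 * a - 105 * a ^ 2 + 70 * a ^ 3 - 15 * a ^ 4) / 24"
    "crp a 4 2 = (70 * a ^ 2 - 120 * a ^ 3 + 50 * a ^ 4) / 24"
    "crp a 4 3 = (60 * a ^ 3 - 60 * a ^ 4) / 24"
    "crp a 4 4 = (24 * a ^ 4) / 24"
    by (simp_all add: crp_rec[of 4] crp_eq_0 r3[unfolded One_nat_def] field_simps power_numeral_reduce)
  have r5: "crp a 5 0 = (120 - 274 * a + 225 * a ^ 2 - 85 * a ^ 3 + 15 * a ^ 4 - 1 * a ^ 5) / 120"
    "crp a 5 1 = (274 * a - 675 * a ^ 2 + 595 * a ^ 3 - 225 * a ^ 4 + 31 * a ^ 5) / 120"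
    "crp a 5 2 = (450 * a ^ 2 - 1020 * a ^ 3 + 750 * a ^ 4 - 180 * a ^ 5) / 120"
    "crp a 5 3 = (510 * a ^ 3 - 900 * a ^ 4 + 390 * a ^ 5) / 120"
    "crp a 5 4 = (360 * a ^ 4 - 360 * a ^ 5) / 120"
    "crp a 5 5 = (120 * a ^ 5) / 120"
    by (simp_all add: crp_rec[of 5] crp_eq_0 r4[unfolded One_nat_def] field_simps power_numeral_reduce)
  have r6: "crp a 6 0 = (720 - 1764 * a + 1624 * a ^ 2 - 735 * a ^ 3 + 175 * a ^ 4 - 21 * a ^ 5 + 1 * a ^ 6) / 720"
    "crp a 6 1 = (1764 * a - 4872 * a ^ 2 + 5145 * a ^ 3 - 2625 * a ^ 4 + 651 * a ^ 5 - 63 * a ^ 6) / 720"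
    "crp a 6 2 = (3248 * a ^ 2 - 8820 * a ^ 3 + 8750 * a ^ 4 - 3780 * a ^ 5 + 602 * a ^ 6) / 720"
    "crp a 6 3 = (4410 * a ^ 3 - 10500 * a ^ 4 + 8190 * a ^ 5 - 2100 * a ^ 6) / 720"
    "crp a 6 4 = (4200 * a ^ 4 - 7560 * a ^ 5 + 3360 * a ^ 6) / 720"
    "crp a 6 5 = (2520 * a ^ 5 - 2520 * a ^ 6) / 720"
    "crp a 6 6 = (720 * a ^ 6) / 720"
    by (simp_all add: crp_rec[of 6] crp_eq_0 r5[unfolded One_nat_def] field_simps power_numeral_reduce)
  have r7: "crp a 7 1 = (13068 * a - 39396 * a ^ 2 + 47383 * a ^ 3 - 29400 * a ^ 4 + 9982 * a ^ 5 - 1764 * a ^ 6 + 127 * a ^ 7) / 5040"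
    "crp a 7 2 = (26264 * a ^ 2 - 81228 * a ^ 3 + 98000 * a ^ 4 - 57960 * a ^ 5 + 16856 * a ^ 6 - 1932 * a ^ 7) / 5040"
    "crp a 7 3 = (40614 * a ^ 3 - 117600 * a ^ 4 + 125580 * a ^ 5 - 58800 * a ^ 6 + 10206 * a ^ 7) / 5040"
    "crp a 7 4 = (47040 * a ^ 4 - 115920 * a ^ 5 + 94080 * a ^ 6 - 25200 * a ^ 7) / 5040"
    "crp a 7 5 = (38640 * a ^ 5 - 70560 * a ^ 6 + 31920 * a ^ 7) / 5040"
    "crp a 7 6 = (20160 * a ^ 6 - 20160 * a ^ 7) / 5040"
    "crp a 7 7 = (5040 * a ^ 7) / 5040"
    by (simp_all add: crp_rec[of 7] crp_eq_0 r6[unfolded One_nat_def] field_simps power_numeral_reduce)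
  from r7 show "crp a 7 1 = (13068 * a - 39396 * a ^ 2 + 47383 * a ^ 3 - 29400 * a ^ 4 + 9982 * a ^ 5 - 1764 * a ^ 6 + 127 * a ^ 7) / 5040"
   "crp a 7 2 = (26264 * a ^ 2 - 81228 * a ^ 3 + 98000 * a ^ 4 - 57960 * a ^ 5 + 16856 * a ^ 6 - 1932 * a ^ 7) / 5040"
   "crp a 7 3 = (40614 * a ^ 3 - 117600 * a ^ 4 + 125580 * a ^ 5 - 58800 * a ^ 6 + 10206 * a ^ 7) / 5040"
   "crp a 7 4 = (47040 * a ^ 4 - 115920 * a ^ 5 + 94080 * a ^ 6 - 25200 * a ^ 7) / 5040"
   "crp a 7 5 = (38640 * a ^ 5 - 70560 * a ^ 6 + 31920 * a ^ 7) / 5040"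
   "crp a 7 6 = (20160 * a ^ 6 - 20160 * a ^ 7) / 5040"
   "crp a 7 7 = (5040 * a ^ 7) / 5040" by simp_all
qed

lemma crp_disc_7:
  assumes a: "0 < a" "a \<le> 17/22" and j: "2 \<le> j"
  shows "0 \<le> crp_disc a 7 j"
proof -
  \<comment> \<open>In the variable \<open>t >= 0\<close> each polynomial cofactor of a discriminant
    has nonnegative coefficients, after multiplication by the power of 22 that clears denominators.
    The bound \<open>17/22 = 0.7727...\<close> lies just above \<open>alpha_star\<close>.\<close>
  define t where "t = 17 - 22 * a"
  have t: "0 \<le> t" using a by (simp add: t_def)
  have scale: "5040\<^sup>2 * ((x / 5040)\<^sup>2 - y / 5040 * (z / 5040)) = x\<^sup>2 - y * z" for x y z :: real
    by (simp add: power2_eq_square)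
  have e2: "54875873536 * (11360996 - 57986468 * a + 126042481 * a ^ 2 - 153012170 * a ^ 3 + 113811667 * a ^ 4 - 53237936 * a ^ 5 + 15323015 * a ^ 6 - 2484834 * a ^ 7 + 174033 * a ^ 8) = 21209356726929 + 716622775100676 * t + 232225014989412 * t ^ 2 + 31127410408668 * t ^ 3 + 2243632285142 * t ^ 4 + 94299652796 * t ^ 5 + 2319318884 * t ^ 6 + 30997860 * t ^ 7 + 174033 * t ^ 8"
    unfolding t_def by algebra
  have "0 \<le> 21209356726929 + 716622775100676 * t + 232225014989412 * t ^ 2 + 31127410408668 * t ^ 3 + 2243632285142 * t ^ 4 + 94299652796 * t ^ 5 + 2319318884 * t ^ 6 + 30997860 * t ^ 7 + 174033 * t ^ 8"
    using t by (intro add_nonneg_nonneg mult_nonneg_nonneg zero_le_power) auto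
  then have n2: "0 \<le> 11360996 - 57986468 * a + 126042481 * a ^ 2 - 153012170 * a ^ 3 + 113811667 * a ^ 4 - 53237936 * a ^ 5 + 15323015 * a ^ 6 - 2484834 * a ^ 7 + 174033 * a ^ 8"
    unfolding e2[symmetric] by simp
  have "(26264 * a ^ 2 - 81228 * a ^ 3 + 98000 * a ^ 4 - 57960 * a ^ 5 + 16856 * a ^ 6 - 1932 * a ^ 7)\<^sup>2 - (13068 * a - 39396 * a ^ 2 + 47383 * a ^ 3 - 29400 * a ^ 4 + 9982 * a ^ 5 - 1764 * a ^ 6 + 127 * a ^ 7) * (40614 * a ^ 3 - 117600 * a ^ 4 + 125580 * a ^ 5 - 58800 * a ^ 6 + 10206 * a ^ 7) = 14 * a ^ 4 * (1 - a) ^ 2 * (11360996 - 57986468 * a + 126042481 * a ^ 2 - 153012170 * a ^ 3 + 113811667 * a ^ 4 - 53237936 * a ^ 5 + 15323015 * a ^ 6 - 2484834 * a ^ 7 + 174033 * a ^ 8)"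
    by algebra
  moreover have "crp_disc a 7 2 = ((26264 * a ^ 2 - 81228 * a ^ 3 + 98000 * a ^ 4 - 57960 * a ^ 5 + 16856 * a ^ 6 - 1932 * a ^ 7) / 5040)\<^sup>2 - (13068 * a - 39396 * a ^ 2 + 47383 * a ^ 3 - 29400 * a ^ 4 + 9982 * a ^ 5 - 1764 * a ^ 6 + 127 * a ^ 7) / 5040 * ((40614 * a ^ 3 - 117600 * a ^ 4 + 125580 * a ^ 5 - 58800 * a ^ 6 + 10206 * a ^ 7) / 5040)"
    by (simp add: crp_disc_def crp_7[unfolded One_nat_def])
  ultimately have "5040\<^sup>2 * crp_disc a 7 2 = 14 * a ^ 4 * (1 - a) ^ 2 * (11360996 - 57986468 * a + 126042481 * a ^ 2 - 153012170 * a ^ 3 + 113811667 * a ^ 4 - 53237936 * a ^ 5 + 15323015 * a ^ 6 - 2484834 * a ^ 7 + 174033 * a ^ 8)"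
    by (simp only: scale)
  moreover have "0 \<le> 14 * a ^ 4 * (1 - a) ^ 2 * (11360996 - 57986468 * a + 126042481 * a ^ 2 - 153012170 * a ^ 3 + 113811667 * a ^ 4 - 53237936 * a ^ 5 + 15323015 * a ^ 6 - 2484834 * a ^ 7 + 174033 * a ^ 8)"
    using a n2 by (intro mult_nonneg_nonneg zero_le_power) auto
  ultimately have d2: "0 \<le> crp_disc a 7 2" by simp
  have e3: "113379904 * (704147 - 3161306 * a + 5785461 * a ^ 2 - 5543692 * a ^ 3 + 2941261 * a ^ 4 - 820986 * a ^ 5 + 94347 * a ^ 6) = 63889992243 + 153961289658 * t + 44087449461 * t ^ 2 + 5154204044 * t ^ 3 + 297320749 * t ^ 4 + 8438298 * t ^ 5 + 94347 * t ^ 6"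
    unfolding t_def by algebra
  have "0 \<le> 63889992243 + 153961289658 * t + 44087449461 * t ^ 2 + 5154204044 * t ^ 3 + 297320749 * t ^ 4 + 8438298 * t ^ 5 + 94347 * t ^ 6"
    using t by (intro add_nonneg_nonneg mult_nonneg_nonneg zero_le_power) auto
  then have n3: "0 \<le> 704147 - 3161306 * a + 5785461 * a ^ 2 - 5543692 * a ^ 3 + 2941261 * a ^ 4 - 820986 * a ^ 5 + 94347 * a ^ 6"
    unfolding e3[symmetric] by simp
  have "(40614 * a ^ 3 - 117600 * a ^ 4 + 125580 * a ^ 5 - 58800 * a ^ 6 + 10206 * a ^ 7)\<^sup>2 - (26264 * a ^ 2 - 81228 * a ^ 3 + 98000 * a ^ 4 - 57960 * a ^ 5 + 16856 * a ^ 6 - 1932 * a ^ 7) * (47040 * a ^ 4 - 115920 * a ^ 5 + 94080 * a ^ 6 - 25200 * a ^ 7) = 588 * a ^ 6 * (1 - a) ^ 2 * (704147 - 3161306 * a + 5785461 * a ^ 2 - 5543692 * a ^ 3 + 2941261 * a ^ 4 - 820986 * a ^ 5 + 94347 * a ^ 6)"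
    by algebra
  moreover have "crp_disc a 7 3 = ((40614 * a ^ 3 - 117600 * a ^ 4 + 125580 * a ^ 5 - 58800 * a ^ 6 + 10206 * a ^ 7) / 5040)\<^sup>2 - (26264 * a ^ 2 - 81228 * a ^ 3 + 98000 * a ^ 4 - 57960 * a ^ 5 + 16856 * a ^ 6 - 1932 * a ^ 7) / 5040 * ((47040 * a ^ 4 - 115920 * a ^ 5 + 94080 * a ^ 6 - 25200 * a ^ 7) / 5040)"
    by (simp add: crp_disc_def crp_7[unfolded One_nat_def])
  ultimately have "5040\<^sup>2 * crp_disc a 7 3 = 588 * a ^ 6 * (1 - a) ^ 2 * (704147 - 3161306 * a + 5785461 * a ^ 2 - 5543692 * a ^ 3 + 2941261 * a ^ 4 - 820986 * a ^ 5 + 94347 * a ^ 6)"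
    by (simp only: scale)
  moreover have "0 \<le> 588 * a ^ 6 * (1 - a) ^ 2 * (704147 - 3161306 * a + 5785461 * a ^ 2 - 5543692 * a ^ 3 + 2941261 * a ^ 4 - 820986 * a ^ 5 + 94347 * a ^ 6)"
    using a n3 by (intro mult_nonneg_nonneg zero_le_power) auto
  ultimately have d3: "0 \<le> crp_disc a 7 3" by simp
  have e4: "234256 * (9119 - 31308 * a + 39402 * a ^ 2 - 21628 * a ^ 3 + 4383 * a ^ 4) = 8714223 + 11366028 * t + 2404074 * t ^ 2 + 177772 * t ^ 3 + 4383 * t ^ 4"
    unfolding t_def by algebra
  have "0 \<le> 8714223 + 11366028 * t + 2404074 * t ^ 2 + 177772 * t ^ 3 + 4383 * t ^ 4"
    using t by (intro add_nonneg_nonneg mult_nonneg_nonneg zero_le_power) auto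
  then have n4: "0 \<le> 9119 - 31308 * a + 39402 * a ^ 2 - 21628 * a ^ 3 + 4383 * a ^ 4"
    unfolding e4[symmetric] by simp
  have "(47040 * a ^ 4 - 115920 * a ^ 5 + 94080 * a ^ 6 - 25200 * a ^ 7)\<^sup>2 - (40614 * a ^ 3 - 117600 * a ^ 4 + 125580 * a ^ 5 - 58800 * a ^ 6 + 10206 * a ^ 7) * (38640 * a ^ 5 - 70560 * a ^ 6 + 31920 * a ^ 7) = 70560 * a ^ 8 * (1 - a) ^ 2 * (9119 - 31308 * a + 39402 * a ^ 2 - 21628 * a ^ 3 + 4383 * a ^ 4)"
    by algebra
  moreover have "crp_disc a 7 4 = ((47040 * a ^ 4 - 115920 * a ^ 5 + 94080 * a ^ 6 - 25200 * a ^ 7) / 5040)\<^sup>2 - (40614 * a ^ 3 - 117600 * a ^ 4 + 125580 * a ^ 5 - 58800 * a ^ 6 + 10206 * a ^ 7) / 5040 * ((38640 * a ^ 5 - 70560 * a ^ 6 + 31920 * a ^ 7) / 5040)"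
    by (simp add: crp_disc_def crp_7[unfolded One_nat_def])
  ultimately have "5040\<^sup>2 * crp_disc a 7 4 = 70560 * a ^ 8 * (1 - a) ^ 2 * (9119 - 31308 * a + 39402 * a ^ 2 - 21628 * a ^ 3 + 4383 * a ^ 4)"
    by (simp only: scale)
  moreover have "0 \<le> 70560 * a ^ 8 * (1 - a) ^ 2 * (9119 - 31308 * a + 39402 * a ^ 2 - 21628 * a ^ 3 + 4383 * a ^ 4)"
    using a n4 by (intro mult_nonneg_nonneg zero_le_power) auto
  ultimately have d4: "0 \<le> crp_disc a 7 4" by simp
  have e5: "484 * (193 - 382 * a + 181 * a ^ 2) = 2853 + 2250 * t + 181 * t ^ 2"
    unfolding t_def by algebra
  have "0 \<le> 2853 + 2250 * t + 181 * t ^ 2"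
    using t by (intro add_nonneg_nonneg mult_nonneg_nonneg zero_le_power) auto
  then have n5: "0 \<le> 193 - 382 * a + 181 * a ^ 2"
    unfolding e5[symmetric] by simp
  have "(38640 * a ^ 5 - 70560 * a ^ 6 + 31920 * a ^ 7)\<^sup>2 - (47040 * a ^ 4 - 115920 * a ^ 5 + 94080 * a ^ 6 - 25200 * a ^ 7) * (20160 * a ^ 6 - 20160 * a ^ 7) = 2822400 * a ^ 10 * (1 - a) ^ 2 * (193 - 382 * a + 181 * a ^ 2)"
    by algebra
  moreover have "crp_disc a 7 5 = ((38640 * a ^ 5 - 70560 * a ^ 6 + 31920 * a ^ 7) / 5040)\<^sup>2 - (47040 * a ^ 4 - 115920 * a ^ 5 + 94080 * a ^ 6 - 25200 * a ^ 7) / 5040 * ((20160 * a ^ 6 - 20160 * a ^ 7) / 5040)"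
    by (simp add: crp_disc_def crp_7[unfolded One_nat_def])
  ultimately have "5040\<^sup>2 * crp_disc a 7 5 = 2822400 * a ^ 10 * (1 - a) ^ 2 * (193 - 382 * a + 181 * a ^ 2)"
    by (simp only: scale)
  moreover have "0 \<le> 2822400 * a ^ 10 * (1 - a) ^ 2 * (193 - 382 * a + 181 * a ^ 2)"
    using a n5 by (intro mult_nonneg_nonneg zero_le_power) auto
  ultimately have d5: "0 \<le> crp_disc a 7 5" by simp
  have e6: "22 * (25 - 29 * a) = 57 + 29 * t"
    unfolding t_def by algebra
  have "0 \<le> 57 + 29 * t"
    using t by (intro add_nonneg_nonneg mult_nonneg_nonneg zero_le_power) auto
  then have n6: "0 \<le> 25 - 29 * a"
    unfolding e6[symmetric] by simp
  have "(20160 * a ^ 6 - 20160 * a ^ 7)\<^sup>2 - (38640 * a ^ 5 - 70560 * a ^ 6 + 31920 * a ^ 7) * (5040 * a ^ 7) = 8467200 * a ^ 12 * (1 - a) ^ 1 * (25 - 29 * a)"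
    by algebra
  moreover have "crp_disc a 7 6 = ((20160 * a ^ 6 - 20160 * a ^ 7) / 5040)\<^sup>2 - (38640 * a ^ 5 - 70560 * a ^ 6 + 31920 * a ^ 7) / 5040 * ((5040 * a ^ 7) / 5040)"
    by (simp add: crp_disc_def crp_7[unfolded One_nat_def])
  ultimately have "5040\<^sup>2 * crp_disc a 7 6 = 8467200 * a ^ 12 * (1 - a) ^ 1 * (25 - 29 * a)"
    by (simp only: scale)
  moreover have "0 \<le> 8467200 * a ^ 12 * (1 - a) ^ 1 * (25 - 29 * a)"
    using a n6 by (intro mult_nonneg_nonneg zero_le_power) auto
  ultimately have d6: "0 \<le> crp_disc a 7 6" by simp
  consider "j = 2" | "j = 3" | "j = 4" | "j = 5" | "j = 6" | "7 \<le> j" using j by linarith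
  then show ?thesis
  proof cases
    case 6
    then show ?thesis by (simp add: crp_disc_def crp_eq_0)
  qed (use d2 d3 d4 d5 d6 in simp_all)
qed

subsection \<open>Ratios of reciprocal Gamma values\<close>

text \<open>The factorials and powers of \<open>m\<close> in \<open>pochhammer_asymp\<close> cancel,
  since \<open>z - d\<close> and \<open>z + d\<close> average to \<open>z\<close>.\<close>

lemma pochhammer_ratio_LIMSEQ:
  fixes z d :: real
  assumes "rGamma z \<noteq> 0"
  shows "(\<lambda>m. pochhammer (z - d) m * pochhammer (z + d) m / (pochhammer z m)\<^sup>2)
    \<longlonglongrightarrow> rGamma (z - d) * rGamma (z + d) / (rGamma z)\<^sup>2"
proof -
  define f where "f x m = pochhammer x m / fact m * real m powr (1 - x)" for x :: real and m :: nat
  have f: "f x \<longlonglongrightarrow> rGamma x" for x unfolding f_def by (rule pochhammer_asymp)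
  have "(\<lambda>m. f (z - d) m * f (z + d) m / (f z m)\<^sup>2) \<longlonglongrightarrow> rGamma (z - d) * rGamma (z + d) / (rGamma z)\<^sup>2"
    using assms by (intro tendsto_intros f) simp
  moreover have "\<forall>\<^sub>F m in sequentially. f (z - d) m * f (z + d) m / (f z m)\<^sup>2
      = pochhammer (z - d) m * pochhammer (z + d) m / (pochhammer z m)\<^sup>2"
    using eventually_gt_at_top[of "0::nat"]
  proof eventually_elim
    case (elim m)
    define P where "P = real m powr (1 - z)"
    have "real m powr (1 - (z - d)) * real m powr (1 - (z + d)) = P\<^sup>2"
      by (simp add: P_def powr_add[symmetric] power2_eq_square)
    moreover have "P \<noteq> 0" using elim by (simp add: P_def)
    moreover have "f (z - d) m * f (z + d) m
        = pochhammer (z - d) m * pochhammer (z + d) m / (fact m)\<^sup>2 * (real m powr (1 - (z - d)) * real m powr (1 - (z + d)))"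
      by (simp add: f_def power2_eq_square)
    moreover have "(f z m)\<^sup>2 = (pochhammer z m)\<^sup>2 / (fact m)\<^sup>2 * P\<^sup>2"
      by (simp add: f_def P_def power_mult_distrib power_divide)
    ultimately show ?case by simp
  qed
  ultimately show ?thesis by (simp add: tendsto_cong)
qed

lemma pochhammer_ratio_Suc:
  fixes z d :: real
  assumes "z + real m \<noteq> 0"
  shows "pochhammer (z - d) (Suc m) * pochhammer (z + d) (Suc m) / (pochhammer z (Suc m))\<^sup>2
    = pochhammer (z - d) m * pochhammer (z + d) m / (pochhammer z m)\<^sup>2 * (1 - d\<^sup>2 / (z + real m)\<^sup>2)"
proof -
  have "1 - d\<^sup>2 / (z + real m)\<^sup>2 = ((z + real m)\<^sup>2 - d\<^sup>2) / (z + real m)\<^sup>2"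
    using assms by (simp add: diff_divide_distrib)
  also have "(z + real m)\<^sup>2 - d\<^sup>2 = (z - d + real m) * (z + d + real m)"
    by (simp add: algebra_simps power2_eq_square)
  finally have "1 - d\<^sup>2 / (z + real m)\<^sup>2 = (z - d + real m) * (z + d + real m) / (z + real m)\<^sup>2" .
  then show ?thesis
    by (simp add: pochhammer_rec' power_mult_distrib mult_ac)
qed

lemma pochhammer_ratio_prod:
  fixes z d :: real
  assumes "\<And>l. l < m \<Longrightarrow> z + real l \<noteq> 0"
  shows "pochhammer (z - d) m * pochhammer (z + d) m / (pochhammer z m)\<^sup>2 = (\<Prod>l<m. 1 - d\<^sup>2 / (z + real l)\<^sup>2)"
  using assms by (induction m) (simp_all add: pochhammer_ratio_Suc)

text \<open>The remainder \<open>\<Prod>l\<ge>m. 1 - d\<^sup>2 / (z + l)\<^sup>2\<close> is compared with the rational function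
  \<open>(y - A) / (y + A)\<close>, \<open>y = z + m - 1/2\<close>: the value \<open>A = d\<^sup>2 / 2\<close> makes the leading terms of the
  logarithmic increments agree and bounds it from below, a slightly smaller \<open>A\<close> from above.\<close>
lemma
  fixes z d A :: real
  defines "r \<equiv> \<lambda>m. pochhammer (z - d) m * pochhammer (z + d) m / (pochhammer z m)\<^sup>2"
    and "h \<equiv> \<lambda>m. (z + real m - 1/2 - A) / (z + real m - 1/2 + A)"
  assumes z: "rGamma z \<noteq> 0" and A: "0 \<le> A" and m: "1/2 < z + real m" and r: "0 \<le> r m" "d\<^sup>2 \<le> (z + real m)\<^sup>2"
  shows pochhammer_ratio_ge:
      "d\<^sup>2 \<le> 2 * A \<Longrightarrow> r m * h m \<le> rGamma (z - d) * rGamma (z + d) / (rGamma z)\<^sup>2"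
    and pochhammer_ratio_le:
      "d\<^sup>2 * (1/2 - A)\<^sup>2 \<le> (d\<^sup>2 - 2 * A) * (z + real m)\<^sup>2 \<Longrightarrow> 2 * A \<le> d\<^sup>2 \<Longrightarrow>
        rGamma (z - d) * rGamma (z + d) / (rGamma z)\<^sup>2 \<le> r m * h m"
proof -
  have x: "1/2 < z + real k" "(z + real m)\<^sup>2 \<le> (z + real k)\<^sup>2" if "m \<le> k" for k
    using m that by (auto intro!: power_mono)
  have rS: "r (Suc k) = r k * (1 - d\<^sup>2 / (z + real k)\<^sup>2)" if "m \<le> k" for k
    unfolding r_def using x[OF that] by (intro pochhammer_ratio_Suc) simp
  have fac: "0 \<le> 1 - d\<^sup>2 / (z + real k)\<^sup>2" if "m \<le> k" for k
    using x[OF that] r(2) by (simp add: divide_le_eq)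
  have rk: "0 \<le> r k" if "m \<le> k" for k
    using that by (induction k rule: dec_induct) (auto simp: r(1) rS intro!: mult_nonneg_nonneg fac)
  have hdiff: "(1 - d\<^sup>2 / (z + real k)\<^sup>2) * h (Suc k) - h k
       = ((2 * A - d\<^sup>2) * (z + real k)\<^sup>2 + d\<^sup>2 * (1/2 - A)\<^sup>2)
          / ((z + real k)\<^sup>2 * (z + real k + 1/2 + A) * (z + real k - 1/2 + A))" if "m \<le> k" for k
  proof -
    define y where "y = z + real k"
    have y: "y \<noteq> 0" "y + 1/2 + A \<noteq> 0" "y - 1/2 + A \<noteq> 0" using x[OF that] A by (auto simp: y_def)
    have "(1 - d\<^sup>2 / y\<^sup>2) * ((y + 1/2 - A) / (y + 1/2 + A)) - (y - 1/2 - A) / (y - 1/2 + A)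
      = ((y\<^sup>2 - d\<^sup>2) * (y + 1/2 - A) * (y - 1/2 + A) - y\<^sup>2 * (y - 1/2 - A) * (y + 1/2 + A)) / (y\<^sup>2 * (y + 1/2 + A) * (y - 1/2 + A))"
    proof -
      have "(1 - d\<^sup>2 / y\<^sup>2) = (y\<^sup>2 - d\<^sup>2) / y\<^sup>2" using y by (simp add: diff_divide_distrib)
      moreover have "p / q * (s / t) - v / w = (p * s * w - q * v * t) / (q * t * w)" if "q \<noteq> 0" "t \<noteq> 0" "w \<noteq> 0" for p q s t v w :: real
        using that by (simp add: field_simps)
      ultimately show ?thesis using y by simp
    qed
    also have "(y\<^sup>2 - d\<^sup>2) * (y + 1/2 - A) * (y - 1/2 + A) - y\<^sup>2 * (y - 1/2 - A) * (y + 1/2 + A)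
      = (2 * A - d\<^sup>2) * y\<^sup>2 + d\<^sup>2 * (1/2 - A)\<^sup>2"
      by (simp add: algebra_simps power2_eq_square) (simp add: field_simps)?
    finally show ?thesis by (simp add: h_def y_def algebra_simps)
  qed
  have den: "0 < (z + real k)\<^sup>2 * (z + real k + 1/2 + A) * (z + real k - 1/2 + A)" if "m \<le> k" for k
    using x[OF that] A by (intro mult_pos_pos) auto
  have h1: "h \<longlonglongrightarrow> 1"
  proof -
    have "(\<lambda>k. (1 + (z - 1/2 - A) * (1 / real k)) / (1 + (z - 1/2 + A) * (1 / real k))) \<longlonglongrightarrow> (1 + (z - 1/2 - A) * 0) / (1 + (z - 1/2 + A) * 0)"
      by (intro tendsto_intros lim_1_over_n) auto
    moreover have "\<forall>\<^sub>F k in sequentially. (1 + (z - 1/2 - A) * (1 / real k)) / (1 + (z - 1/2 + A) * (1 / real k)) = h k"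
      using eventually_gt_at_top[of "0::nat"]
    proof eventually_elim
      case (elim k)
      then have "real k * (1 + c * (1 / real k)) = c + real k" for c by (simp add: distrib_left)
      then have "h k = (real k * (1 + (z - 1/2 - A) * (1 / real k))) / (real k * (1 + (z - 1/2 + A) * (1 / real k)))"
        by (simp only: h_def) (simp add: algebra_simps)
      then show ?case using elim by simp
    qed
    ultimately show ?thesis by (simp add: tendsto_cong)
  qed
  \<comment> \<open>\<open>w\<close> tends to the Gamma ratio because \<open>h\<close> tends to 1.
    The sign of the numerator in \<open>hdiff\<close> makes it monotone, so its first term is the
    desired bound.\<close>
  define w where "w i = r (m + i) * h (m + i)" for i
  have "(\<lambda>k. r k * h k) \<longlonglongrightarrow> rGamma (z - d) * rGamma (z + d) / (rGamma z)\<^sup>2 * 1"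
    unfolding r_def by (intro tendsto_mult h1 pochhammer_ratio_LIMSEQ z)
  then have w: "w \<longlonglongrightarrow> rGamma (z - d) * rGamma (z + d) / (rGamma z)\<^sup>2"
    unfolding w_def using LIMSEQ_ignore_initial_segment[of "\<lambda>k. r k * h k" _ m] by (simp add: add.commute)
  have wS: "w (Suc i) - w i = r (m + i) * ((1 - d\<^sup>2 / (z + real (m + i))\<^sup>2) * h (Suc (m + i)) - h (m + i))" for i
  proof -
    have "b * f * u - b * v = b * (f * u - v)" for b f u v :: real by (simp add: algebra_simps)
    then show ?thesis unfolding w_def add_Suc_right rS[OF le_add1] .
  qed
  {
    assume "d\<^sup>2 \<le> 2 * A"
    have "w i \<le> w (Suc i)" for i
    proof -
      have "0 \<le> w (Suc i) - w i"
        unfolding wS hdiff[OF le_add1] using rk[OF le_add1] den[OF le_add1] \<open>d\<^sup>2 \<le> 2 * A\<close>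
        by (intro mult_nonneg_nonneg divide_nonneg_pos add_nonneg_nonneg) auto
      then show ?thesis by simp
    qed
    then have "incseq w" by (intro incseq_SucI)
    then show "r m * h m \<le> rGamma (z - d) * rGamma (z + d) / (rGamma z)\<^sup>2"
      using incseq_le[OF _ w, of 0] by (simp add: w_def)
  next
    assume *: "d\<^sup>2 * (1/2 - A)\<^sup>2 \<le> (d\<^sup>2 - 2 * A) * (z + real m)\<^sup>2" "2 * A \<le> d\<^sup>2"
    have "w (Suc i) \<le> w i" for i
    proof -
      have "(d\<^sup>2 - 2 * A) * (z + real m)\<^sup>2 \<le> (d\<^sup>2 - 2 * A) * (z + real (m + i))\<^sup>2"
        using * x[of "m + i"] by (intro mult_left_mono) auto
      then have "(2 * A - d\<^sup>2) * (z + real (m + i))\<^sup>2 + d\<^sup>2 * (1/2 - A)\<^sup>2 \<le> 0"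
        using *(1) by (simp add: algebra_simps)
      then have "w (Suc i) - w i \<le> 0"
        unfolding wS hdiff[OF le_add1] using rk[OF le_add1] den[OF le_add1]
        by (intro mult_nonneg_nonpos divide_nonpos_pos) auto
      then show ?thesis by simp
    qed
    then have "decseq w" by (intro decseq_SucI)
    then show "rGamma (z - d) * rGamma (z + d) / (rGamma z)\<^sup>2 \<le> r m * h m"
      using decseq_ge[OF _ w, of 0] by (simp add: w_def)
  }
qed

subsection \<open>Propagation at the critical index\<close>

text \<open>Sign count: \<open>1 - 2 * a\<close> is the sole negative factor of the first product,
  while \<open>1 - 3 * a\<close> and \<open>2 - 3 * a\<close> are the two negative factors of the
  second.\<close>

lemma
  fixes a :: real
  assumes a: "2/3 < a" "a < 1" and m: "2 \<le> m"
  shows pochhammer_1_minus_2_neg: "pochhammer (1 - 2 * a) m < 0"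
    and pochhammer_1_minus_3_pos: "0 < pochhammer (1 - 3 * a) m"
proof -
  have "m = Suc (Suc (m - 2))" using m by simp
  then obtain k where k: "m = Suc (Suc k)" by blast
  have "0 < pochhammer (3 - 3 * a) k" using a by (intro pochhammer_pos) simp
  then have "0 < (1 - 3 * a) * ((2 - 3 * a) * pochhammer (3 - 3 * a) k)"
    using a by (intro mult_neg_neg mult_neg_pos) auto
  then show "0 < pochhammer (1 - 3 * a) m"
    unfolding k pochhammer_rec by simp
  have "0 < pochhammer (2 - 2 * a) (Suc k)" using a by (intro pochhammer_pos) simp
  then show "pochhammer (1 - 2 * a) m < 0"
    using a unfolding k pochhammer_rec[of "1 - 2 * a" "Suc k"] by (simp add: mult_neg_pos)
qed

text \<open>By \<open>G\<close> the infinite product is at most 1. Its tail from \<open>m\<close> on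
  is at least \<open>(y - a^2 / 2) / (y + a^2 / 2)\<close>, so the partial product is at most the
  reciprocal, which is at most \<open>n / (n - a)\<close> as soon as
  \<open>n * a <= y + a^2 / 2\<close>.\<close>

lemma pochhammer_ratio_bound:
  fixes a :: real
  assumes a: "2/3 < a" "a \<le> 17/22" and m: "7 \<le> m"
    and G: "rGamma (1 - a) * rGamma (1 - 3 * a) \<le> (rGamma (1 - 2 * a))\<^sup>2"
  shows "pochhammer (1 - a) m * pochhammer (1 - 3 * a) m
     \<le> real (Suc m) / (real (Suc m) - a) * (pochhammer (1 - 2 * a) m)\<^sup>2"
proof -
  define n where "n = real (Suc m)"
  define r where "r = pochhammer (1 - 2 * a - a) m * pochhammer (1 - 2 * a + a) m / (pochhammer (1 - 2 * a) m)\<^sup>2"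
  define y where "y = 1 - 2 * a + real m - 1/2"
  have n: "8 \<le> n" "real m = n - 1" using m by (simp_all add: n_def)
  have pos1: "0 < pochhammer (1 - a) m" using a by (intro pochhammer_pos) simp
  have pos3: "0 < pochhammer (1 - 3 * a) m" using a m by (intro pochhammer_1_minus_3_pos) auto
  have neg2: "pochhammer (1 - 2 * a) m < 0" using a m by (intro pochhammer_1_minus_2_neg) auto
  have nz: "rGamma (1 - 2 * a) \<noteq> 0"
  proof -
    have "1 - 2 * a \<notin> \<int>" using a Ints_nonzero_abs_less1[of "1 - 2 * a"] by auto
    then show ?thesis using nonpos_Ints_Int by (auto simp: rGamma_eq_zero_iff)
  qed
  \<comment> \<open>At \<open>n = 8\<close> the inequality \<open>ny\<close> reads
    \<open>0 <= a^2 - 20 * a + 15\<close>. The product here equals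
    \<open>a^2 - 20 * a + 7191/484\<close>, slightly smaller and with a root at
    \<open>17/22\<close>.\<close>
  have *: "0 \<le> (17/22 - a) * (423/22 - a)" using a by (intro mult_nonneg_nonneg) auto
  have "8 * (1 - a) \<le> n * (1 - a)" using n a by (intro mult_right_mono) auto
  moreover have "(17/22 - a) * (423/22 - a) = a\<^sup>2 - 20 * a + 7191 / 484"
    by (simp add: algebra_simps power2_eq_square) (simp add: field_simps)?
  ultimately have ny: "n * a \<le> y + a\<^sup>2 / 2"
    using * n(2) by (simp add: y_def right_diff_distrib)
  have "a\<^sup>2 \<le> a" using a by (simp add: power2_eq_square mult_left_le)
  then have y: "a\<^sup>2 / 2 < y" using n a by (simp add: y_def)
  then have y': "0 < y + a\<^sup>2 / 2" using zero_le_power2[of a] by linarith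
  have "r * ((y - a\<^sup>2 / 2) / (y + a\<^sup>2 / 2)) \<le> rGamma (1 - 2 * a - a) * rGamma (1 - 2 * a + a) / (rGamma (1 - 2 * a))\<^sup>2"
    unfolding r_def y_def
  proof (rule pochhammer_ratio_ge)
    show "0 \<le> pochhammer (1 - 2 * a - a) m * pochhammer (1 - 2 * a + a) m / (pochhammer (1 - 2 * a) m)\<^sup>2"
      using pos1 pos3 by simp
    show "a\<^sup>2 \<le> (1 - 2 * a + real m)\<^sup>2" using a m by (intro power_mono) auto
  qed (use nz a m in auto)
  also have "\<dots> \<le> 1"
    using G nz by (simp add: mult.commute)
  finally have "r * (y - a\<^sup>2 / 2) \<le> y + a\<^sup>2 / 2"
    using y' by (simp add: pos_divide_le_eq)
  then have "r \<le> (y + a\<^sup>2 / 2) / (y - a\<^sup>2 / 2)"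
    using y by (simp add: pos_le_divide_eq)
  also have "\<dots> \<le> n / (n - a)"
  proof (rule frac_le_eq[THEN iffD2])
    show "((y + a\<^sup>2 / 2) * (n - a) - n * (y - a\<^sup>2 / 2)) / ((y - a\<^sup>2 / 2) * (n - a)) \<le> 0"
    proof (rule divide_nonpos_pos)
      have "a * (n * a) \<le> a * (y + a\<^sup>2 / 2)" using ny a by (intro mult_left_mono) auto
      moreover have "(y + q / 2) * (n - a) - n * (y - q / 2) = q * n - a * (y + q / 2)" for q
        by (simp add: field_simps)
      ultimately show "(y + a\<^sup>2 / 2) * (n - a) - n * (y - a\<^sup>2 / 2) \<le> 0"
        by (simp add: power2_eq_square mult_ac)
    qed (use y n a in auto)
  qed (use y n a in auto)
  finally have "r * (pochhammer (1 - 2 * a) m)\<^sup>2 \<le> n / (n - a) * (pochhammer (1 - 2 * a) m)\<^sup>2"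
    by (intro mult_right_mono) auto
  then show ?thesis using neg2 by (simp add: r_def n_def mult.commute del: of_nat_Suc)
qed

text \<open>Here \<open>p0 * e - d\<^sup>2\<close> is the defect of log-concavity at index 1. It is outweighed by the square
  \<open>(d + e)\<^sup>2\<close> in the recursion for the discriminant at index 2.\<close>
lemma log_concave_defect:
  fixes a n p0 d e p3 :: real
  defines "p1 \<equiv> p0 + d"
  defines "p2 \<equiv> p1 + d + e"
  assumes a: "0 < a" "a < 1" and n: "4 \<le> n" and pos: "0 < p0" "0 < d" "0 < e"
    and neg: "d\<^sup>2 < p0 * e" and ratio: "p0 * e \<le> n / (n - a) * d\<^sup>2" and p3: "p1 * p3 \<le> p2\<^sup>2"
  shows "0 \<le> a\<^sup>2 * 3 * (d\<^sup>2 - p0 * e) + (n - 4 * a) * a * (p2 * p1 - p0 * p3) + a\<^sup>2 * (d + e)\<^sup>2"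
proof -
  define D where "D = d\<^sup>2 - p0 * e"
  define u where "u = e / d"
  have u: "0 < u" "e = u * d" using pos by (auto simp: u_def)
  have D: "D < 0" "D = p1\<^sup>2 - p0 * p2"
    using neg by (simp_all add: D_def p1_def p2_def algebra_simps power2_eq_square)
  have p12: "0 < p1" "0 < p2" using pos by (auto simp: p1_def p2_def)
  define R where "R = p2 / p1"
  have R: "R \<le> 1 + u + u\<^sup>2"
  proof -
    have "R = 1 + (d + e) / p1" using p12 by (simp add: R_def p2_def add_divide_distrib)
    also have "(d + e) / p1 \<le> (d + e) / p0"
      using pos p12 by (intro divide_left_mono) (auto simp: p1_def)
    also have "\<dots> \<le> u + u\<^sup>2"
    proof -
      have "d * d < d * (p0 * u)" using neg u by (simp add: power2_eq_square mult_ac)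
      then have d: "d \<le> p0 * u" using pos by simp
      then have "d * (1 + u) \<le> p0 * u * (1 + u)" using u by (intro mult_right_mono) auto
      then have "d + e \<le> (u + u\<^sup>2) * p0" unfolding u(2) by (simp add: algebra_simps power2_eq_square)
      then show ?thesis using pos(1) by (simp add: pos_divide_le_eq)
    qed
    finally show ?thesis by simp
  qed
  \<comment> \<open>Log-concavity at index 2 bounds \<open>p3\<close> by \<open>p2^2 / p1\<close>,
    which leaves \<open>p2 / p1\<close> times the defect \<open>D\<close>.\<close>
  have X: "R * D \<le> p2 * p1 - p0 * p3"
  proof -
    have "p0 * (p1 * p3) \<le> p0 * p2\<^sup>2" using p3 pos by (intro mult_left_mono) auto
    then have "p2 * D \<le> (p2 * p1 - p0 * p3) * p1"
      unfolding D(2) by (simp add: algebra_simps power2_eq_square)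
    then show ?thesis using p12 by (simp add: R_def pos_divide_le_eq)
  qed
  have na: "0 < n - a" "0 \<le> n - 4 * a" using n a by auto
  have "n / (n - a) = 1 + a / (n - a)" using na by (simp add: field_simps)
  then have D_ge: "- D \<le> a / (n - a) * d\<^sup>2"
    using ratio by (simp add: D_def distrib_right)
  \<comment> \<open>Enlarging \<open>3 * a\<close> by the factor \<open>1 + u + u^2\<close> merges
    both coefficients into \<open>n - a\<close>, which cancels the denominator in
    \<open>D_ge\<close>.\<close>
  have "3 * a + (n - 4 * a) * R \<le> 3 * a * (1 + u + u\<^sup>2) + (n - 4 * a) * (1 + u + u\<^sup>2)"
    using R na u a by (intro add_mono mult_left_mono) auto
  also have "\<dots> = (n - a) * (1 + u + u\<^sup>2)" by (simp add: algebra_simps)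
  finally have "(3 * a + (n - 4 * a) * R) * (- D) \<le> ((n - a) * (1 + u + u\<^sup>2)) * (a / (n - a) * d\<^sup>2)"
    using D_ge D(1) na u by (intro mult_mono) auto
  also have "\<dots> = a * (d\<^sup>2 * (1 + u + u\<^sup>2))" using na by simp
  also have "\<dots> \<le> a * (d + e)\<^sup>2"
  proof (rule mult_left_mono)
    have "(d + e)\<^sup>2 = d\<^sup>2 * (1 + u + u\<^sup>2) + d\<^sup>2 * u"
      unfolding u(2) by (simp add: power2_eq_square algebra_simps)
    then show "d\<^sup>2 * (1 + u + u\<^sup>2) \<le> (d + e)\<^sup>2" using u by simp
  qed (use a in simp)
  finally have "a * ((3 * a + (n - 4 * a) * R) * (- D)) \<le> a * (a * (d + e)\<^sup>2)"
    using a by (intro mult_left_mono) auto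
  moreover have "(n - 4 * a) * a * (R * D) \<le> (n - 4 * a) * a * (p2 * p1 - p0 * p3)"
    using X na a by (intro mult_left_mono) auto
  moreover have "a * ((3 * a + (n - 4 * a) * R) * (- D)) = - (a\<^sup>2 * 3 * D) - (n - 4 * a) * a * (R * D)"
    by (simp add: algebra_simps power2_eq_square)
  moreover have "a * (a * (d + e)\<^sup>2) = a\<^sup>2 * (d + e)\<^sup>2" by (simp add: power2_eq_square)
  ultimately show ?thesis unfolding D_def[symmetric] by linarith
qed

text \<open>Among the indices \<open>j >= 2\<close>, this is the one whose recursion contains the
  discriminant at index 1, which may be negative. With \<open>p 0\<close>, \<open>- d\<close>...
  signs aside, the boundary value and the first two differences at 0 are the finite forms of
  \<open>a1\<close>, \<open>a2\<close>, \<open>a3\<close>, so \<open>ratio\<close> limits that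
  defect.\<close>

lemma crp_disc_nonneg_step_2:
  assumes a: "2/3 < a" "a \<le> 17/22" and m: "7 \<le> m"
    and G: "rGamma (1 - a) * rGamma (1 - 3 * a) \<le> (rGamma (1 - 2 * a))\<^sup>2"
    and D: "0 \<le> crp_disc a m 2"
  shows "0 \<le> crp_disc a (Suc m) 2"
proof (cases "0 \<le> crp_disc a m 1")
  case True
  have "a * (real m + 2) \<le> 17/22 * (real m + 2)" using a by (intro mult_right_mono) auto
  also have "\<dots> \<le> real m + 1" using m by simp
  finally show ?thesis using True D a by (intro crp_disc_nonneg_step) auto
next
  case False
  define n where "n = real (Suc m)"
  define p where "p j = crp a m j" for j
  define d where "d = - pochhammer (1 - 2 * a) m / fact m"
  define e where "e = pochhammer (1 - 3 * a) m / fact m"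
  have n: "8 \<le> n" using m by (simp add: n_def)
  have p0: "p 0 = pochhammer (1 - a) m / fact m" using fdiff_crp_at_0[of 0 a m] by (simp add: p_def)
  have p1: "p 1 = p 0 + d" using fdiff_crp_at_0[of 1 a m] by (simp add: p_def d_def fdiff_def)
  have p2: "p 2 = p 0 + d + d + e"
    using fdiff_crp_at_0[of 2 a m] p1 by (simp add: p_def e_def fdiff_def numeral_2_eq_2)
  have pos0: "0 < p 0" using a unfolding p0 by (intro divide_pos_pos pochhammer_pos) auto
  have epos: "0 < e" unfolding e_def using a m by (intro divide_pos_pos pochhammer_1_minus_3_pos) auto
  have dpos: "0 < d" unfolding d_def using a m pochhammer_1_minus_2_neg[of a m] by (simp add: divide_neg_pos)
  have D1: "crp_disc a m 1 = d\<^sup>2 - p 0 * e"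
  proof -
    have "crp_disc a m 1 = (p 1)\<^sup>2 - p 0 * p 2" by (simp add: crp_disc_def p_def numeral_2_eq_2)
    then show ?thesis unfolding p1 p2 by (simp add: algebra_simps power2_eq_square)
  qed
  have D2: "p 1 * p 3 \<le> (p 2)\<^sup>2" using D by (simp add: crp_disc_def p_def)
  have ratio: "p 0 * e \<le> n / (n - a) * d\<^sup>2"
  proof -
    have "pochhammer (1 - a) m * pochhammer (1 - 3 * a) m / (fact m)\<^sup>2 \<le> (n / (n - a) * (pochhammer (1 - 2 * a) m)\<^sup>2) / (fact m)\<^sup>2"
      unfolding n_def by (intro divide_right_mono pochhammer_ratio_bound[OF a m G]) simp
    then show ?thesis by (simp add: p0 e_def d_def power_divide power2_eq_square)
  qed
  have "0 \<le> a\<^sup>2 * 3 * (d\<^sup>2 - p 0 * e) + (n - 4 * a) * a * ((p 0 + d + d + e) * (p 0 + d) - p 0 * p 3) + a\<^sup>2 * (d + e)\<^sup>2"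
    using a n pos0 dpos epos False D1 ratio D2[unfolded p1 p2]
    by (intro log_concave_defect) auto
  moreover have "0 \<le> (n - 2 * a) * (n - 4 * a) * crp_disc a m 2"
    using n a D by (intro mult_nonneg_nonneg) auto
  moreover have "n\<^sup>2 * crp_disc a (Suc m) 2 = (n - 2 * a) * (n - 4 * a) * crp_disc a m 2 + a\<^sup>2 * 3 * crp_disc a m 1
      + (n - 4 * a) * a * (p 2 * p 1 - p 0 * p 3) + a\<^sup>2 * (p 2 - p 1)\<^sup>2"
    unfolding n_def p_def using crp_disc_Suc[of 2 m a]
    by (simp add: mult.commute del: of_nat_Suc crp.simps)
  ultimately have "0 \<le> n\<^sup>2 * crp_disc a (Suc m) 2"
    unfolding D1 p1 p2 by simp
  then show ?thesis using n by (simp add: zero_le_mult_iff)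
qed

text \<open>Above \<open>5/7\<close> the induction starts in row 7, from which on
  \<open>pochhammer_ratio_bound\<close> is available up to \<open>a = 17/22\<close>. Index 2 uses
  its special step and larger indices the ordinary one.\<close>

lemma crp_disc_nonneg:
  assumes a: "0 < a" "a \<le> 17/22"
    and G: "5/7 < a \<Longrightarrow> rGamma (1 - a) * rGamma (1 - 3 * a) \<le> (rGamma (1 - 2 * a))\<^sup>2"
    and m: "7 \<le> m" and j: "2 \<le> j"
  shows "0 \<le> crp_disc a m j"
proof (cases "a \<le> 5/7")
  case True
  then show ?thesis using a m j by (intro crp_disc_nonneg_small) auto
next
  case False
  then have G': "rGamma (1 - a) * rGamma (1 - 3 * a) \<le> (rGamma (1 - 2 * a))\<^sup>2" using G by simp
  show ?thesis
    using m j
  proof (induction m arbitrary: j rule: dec_induct)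
    case base
    then show ?case using a by (intro crp_disc_7)
  next
    case (step m)
    show ?case
    proof (cases "j = 2")
      case True
      have "0 \<le> crp_disc a m 2" by (rule step.IH) simp
      then show ?thesis unfolding True using step.hyps False a G' by (intro crp_disc_nonneg_step_2) auto
    next
      case False
      have "a * (real m + 2) \<le> 17/22 * (real m + 2)" using a by (intro mult_right_mono) auto
      also have "\<dots> \<le> real m + 1" using step by simp
      finally show ?thesis using step False a by (intro crp_disc_nonneg_step) auto
    qed
  qed
qed

subsection \<open>The critical exponent\<close>

definition gamma_ratio :: "real \<Rightarrow> real" where
  "gamma_ratio a = rGamma (1 - a) * rGamma (1 - 3 * a) / (rGamma (1 - 2 * a))\<^sup>2"

lemma rGamma_1_minus_2_nonzero:
  fixes a :: real
  assumes "1/2 < a" "a < 1"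
  shows "rGamma (1 - 2 * a) \<noteq> 0"
proof -
  have "1 - 2 * a \<notin> \<int>" using assms Ints_nonzero_abs_less1[of "1 - 2 * a"] by auto
  then show ?thesis using nonpos_Ints_Int by (auto simp: rGamma_eq_zero_iff)
qed

lemma rGamma_real_pos: "0 < x \<Longrightarrow> 0 < rGamma (x::real)"
  by (simp add: rGamma_inverse_Gamma)

text \<open>The functional equation moves all arguments to the positive values \<open>1 + b\<close>,
  \<open>1 + 2 * b\<close>, \<open>1 + 3 * b\<close>. The rational factor that remains visibly
  decreases in \<open>b\<close>.\<close>

lemma gamma_ratio_eq:
  assumes "1/2 < a" "a < 1"
  defines "b \<equiv> 1 - a"
  shows "gamma_ratio a = 3/4 * (9/4 - 1 / (4 * (1 - 2 * b)\<^sup>2))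
    * (rGamma (1 + 2 * b - b) * rGamma (1 + 2 * b + b) / (rGamma (1 + 2 * b))\<^sup>2)"
proof -
  have r: "rGamma x = x * rGamma (1 + x)" for x :: real
    using rGamma_plus1[of x] by (simp add: add.commute)
  have b: "0 < b" "b < 1/2" using assms by auto
  have 1: "rGamma (1 - a) = b * rGamma (1 + b)"
    using r[of b] by (simp add: b_def)
  have 2: "rGamma (1 - 2 * a) = (2 * b - 1) * (2 * b) * rGamma (1 + 2 * b)"
    using r[of "2 * b - 1"] r[of "2 * b"] by (simp add: b_def)
  have 3: "rGamma (1 - 3 * a) = (3 * b - 2) * (3 * b - 1) * (3 * b) * rGamma (1 + 3 * b)"
    using r[of "3 * b - 2"] r[of "3 * b - 1"] r[of "3 * b"] by (simp add: b_def)
  have nz: "1 - 2 * b \<noteq> 0" "b \<noteq> 0" using b by auto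
  have "gamma_ratio a = (b * ((3 * b - 2) * (3 * b - 1) * (3 * b)) / ((2 * b - 1) * (2 * b))\<^sup>2)
     * (rGamma (1 + b) * rGamma (1 + 3 * b) / (rGamma (1 + 2 * b))\<^sup>2)"
    unfolding gamma_ratio_def 1 2 3 power_mult_distrib by simp
  moreover have "b * ((3 * b - 2) * (3 * b - 1) * (3 * b)) / ((2 * b - 1) * (2 * b))\<^sup>2 = 3/4 * (9/4 - 1 / (4 * (1 - 2 * b)\<^sup>2))"
  proof -
    have "b * ((3 * b - 2) * (3 * b - 1) * (3 * b)) = (b\<^sup>2 * 4) * (3/4 * ((3 * b - 2) * (3 * b - 1)))"
      by (simp add: algebra_simps power2_eq_square)
    moreover have "((2 * b - 1) * (2 * b))\<^sup>2 = (b\<^sup>2 * 4) * (1 - 2 * b)\<^sup>2"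
      by (simp add: algebra_simps power2_eq_square)
    ultimately have eq: "b * ((3 * b - 2) * (3 * b - 1) * (3 * b)) / ((2 * b - 1) * (2 * b))\<^sup>2
       = ((b\<^sup>2 * 4) * (3/4 * ((3 * b - 2) * (3 * b - 1)))) / ((b\<^sup>2 * 4) * (1 - 2 * b)\<^sup>2)"
      by (simp only:)
    have q: "(3 * b - 2) * (3 * b - 1) = 9/4 * (1 - 2 * b)\<^sup>2 - 1/4"
      by (simp add: algebra_simps power2_eq_square)
    show ?thesis
      unfolding eq unfolding q using nz by (subst mult_divide_mult_cancel_left) (simp_all add: diff_divide_distrib)
  qed
  moreover have "1 + 2 * b - b = 1 + b" "1 + 2 * b + b = 1 + 3 * b" by simp_all
  ultimately show ?thesis by (simp only:)
qed

text \<open>In \<open>gamma_ratio_eq\<close> the Gamma part \<open>V\<close> is a product with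
  factors \<open>1 - (x / (1 + 2 * x + l))^2\<close>, decreasing in \<open>x\<close>. The rational
  part \<open>S\<close> decreases strictly and is positive for \<open>x < 1/3\<close>, that is, for
  \<open>a > 2/3\<close>.\<close>

lemma gamma_ratio_strict_mono:
  assumes "2/3 < a" "a < a'" "a' < 1"
  shows "gamma_ratio a < gamma_ratio a'"
proof -
  define b c where "b = 1 - a" and "c = 1 - a'"
  have bc: "0 < c" "c < b" "b < 1/3" using assms by (auto simp: b_def c_def)
  define V where "V x = rGamma (1 + 2 * x - x) * rGamma (1 + 2 * x + x) / (rGamma (1 + 2 * x))\<^sup>2" for x :: real
  define S where "S x = 9/4 - 1 / (4 * (1 - 2 * x)\<^sup>2)" for x :: real
  have Vpos: "0 < V x" if "0 < x" for x
    unfolding V_def using that by (intro divide_pos_pos mult_pos_pos zero_less_power rGamma_real_pos) auto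
  have Vlim: "(\<lambda>m. \<Prod>l<m. 1 - x\<^sup>2 / (1 + 2 * x + real l)\<^sup>2) \<longlonglongrightarrow> V x" if "0 < x" for x
  proof -
    have "rGamma (1 + 2 * x) \<noteq> 0" using rGamma_real_pos[of "1 + 2 * x"] that by simp
    moreover have "pochhammer (1 + 2 * x - x) m * pochhammer (1 + 2 * x + x) m / (pochhammer (1 + 2 * x) m)\<^sup>2
        = (\<Prod>l<m. 1 - x\<^sup>2 / (1 + 2 * x + real l)\<^sup>2)" for m
      by (rule pochhammer_ratio_prod) (use that in linarith)
    ultimately show ?thesis
      using pochhammer_ratio_LIMSEQ[of "1 + 2 * x" x] by (simp only: V_def not_False_eq_True True_implies_equals)
  qed
  have "V b \<le> V c"
  proof (rule LIMSEQ_le[OF Vlim Vlim])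
    have "(\<Prod>l<m. 1 - b\<^sup>2 / (1 + 2 * b + real l)\<^sup>2) \<le> (\<Prod>l<m. 1 - c\<^sup>2 / (1 + 2 * c + real l)\<^sup>2)" for m
    proof (intro prod_mono conjI)
      fix l
      have "b / (1 + 2 * b + real l) \<le> 1" using bc by (simp add: divide_le_eq)
      then have "(b / (1 + 2 * b + real l))\<^sup>2 \<le> 1" using bc by (intro power_le_one) auto
      then show "0 \<le> 1 - b\<^sup>2 / (1 + 2 * b + real l)\<^sup>2" by (simp add: power_divide)
      have "c * (1 + real l) \<le> b * (1 + real l)" using bc by (intro mult_right_mono) auto
      then have "c / (1 + 2 * c + real l) \<le> b / (1 + 2 * b + real l)"
        using bc by (simp add: divide_le_eq le_divide_eq algebra_simps)
      then have "(c / (1 + 2 * c + real l))\<^sup>2 \<le> (b / (1 + 2 * b + real l))\<^sup>2"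
        using bc by (intro power_mono) auto
      then show "1 - b\<^sup>2 / (1 + 2 * b + real l)\<^sup>2 \<le> 1 - c\<^sup>2 / (1 + 2 * c + real l)\<^sup>2"
        by (simp add: power_divide)
    qed
    then show "\<exists>N. \<forall>m\<ge>N. (\<Prod>l<m. 1 - b\<^sup>2 / (1 + 2 * b + real l)\<^sup>2) \<le> (\<Prod>l<m. 1 - c\<^sup>2 / (1 + 2 * c + real l)\<^sup>2)"
      by blast
  qed (use bc in auto)
  moreover have "S b < S c"
  proof -
    have "(1 - 2 * b)\<^sup>2 < (1 - 2 * c)\<^sup>2" using bc by (intro power_strict_mono) auto
    then show ?thesis using bc by (simp add: S_def divide_strict_left_mono)
  qed
  moreover have "0 < S b"
  proof -
    have "(1/3)\<^sup>2 < (1 - 2 * b)\<^sup>2" using bc by (intro power_strict_mono) auto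
    then have "1 / (4 * (1 - 2 * b)\<^sup>2) < 9/4" using bc by (simp add: divide_less_eq power2_eq_square)
    then show ?thesis by (simp add: S_def)
  qed
  ultimately have "S b * V b < S c * V c"
    using Vpos[of b] bc by (intro mult_less_le_imp_less) auto
  moreover have "gamma_ratio a = 3/4 * (S b * V b)" "gamma_ratio a' = 3/4 * (S c * V c)"
    using gamma_ratio_eq[of a] gamma_ratio_eq[of a'] assms
    unfolding V_def S_def b_def c_def mult.assoc by simp_all
  ultimately show ?thesis by simp
qed

text \<open>Below \<open>1/3\<close> all factors of the product lie in \<open>[0, 1]\<close>, and
  the factor at \<open>l = 0\<close> is less than 1.\<close>

lemma gamma_ratio_lt_1_small:
  fixes a :: real
  assumes "0 < a" "a < 1/3"
  shows "rGamma (1 - a) * rGamma (1 - 3 * a) < (rGamma (1 - 2 * a))\<^sup>2"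
proof -
  define c where "c l = 1 - a\<^sup>2 / (1 - 2 * a + real l)\<^sup>2" for l :: nat
  have nz: "0 < rGamma (1 - 2 * a)" using assms by (intro rGamma_real_pos) auto
  have c: "0 \<le> c l" "c l \<le> 1" for l
  proof -
    have "a / (1 - 2 * a + real l) \<le> 1" using assms by (simp add: divide_le_eq)
    then have "(a / (1 - 2 * a + real l))\<^sup>2 \<le> 1" using assms by (intro power_le_one) auto
    then show "0 \<le> c l" "c l \<le> 1" by (simp_all add: c_def power_divide)
  qed
  have lim: "(\<lambda>m. \<Prod>l<m. c l) \<longlonglongrightarrow> rGamma (1 - 2 * a - a) * rGamma (1 - 2 * a + a) / (rGamma (1 - 2 * a))\<^sup>2"
  proof -
    have "pochhammer (1 - 2 * a - a) m * pochhammer (1 - 2 * a + a) m / (pochhammer (1 - 2 * a) m)\<^sup>2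
        = (\<Prod>l<m. c l)" for m
      unfolding c_def by (rule pochhammer_ratio_prod) (use assms in linarith)
    then show ?thesis
      using pochhammer_ratio_LIMSEQ[of "1 - 2 * a" a] nz by simp
  qed
  have "(\<Prod>l<Suc m. c l) \<le> c 0" for m
  proof (induction m)
    case (Suc m)
    have "(\<Prod>l<Suc (Suc m). c l) = (\<Prod>l<Suc m. c l) * c (Suc m)" by simp
    also have "\<dots> \<le> (\<Prod>l<Suc m. c l) * 1" by (intro mult_left_mono c prod_nonneg)
    finally show ?case using Suc by simp
  qed simp
  then have "rGamma (1 - 2 * a - a) * rGamma (1 - 2 * a + a) / (rGamma (1 - 2 * a))\<^sup>2 \<le> c 0"
    by (intro LIMSEQ_le_const2[OF LIMSEQ_Suc[OF lim]]) auto
  also have "c 0 < 1" using assms by (simp add: c_def)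
  finally show ?thesis using nz by (simp add: mult.commute)
qed

text \<open>On \<open>[1/3, 2/3]\<close> the right-hand side is nonpositive, so equality forces both
  sides to vanish. The left-hand side vanishes there only at \<open>1/2\<close>, where the
  right-hand side does not.\<close>

lemma alpha_star_eq_imp_gt:
  assumes a: "0 < a" "a < 1" "alpha_star_eq a"
  shows "2/3 < a"
proof (rule ccontr)
  assume "\<not> 2/3 < a"
  moreover have "1/3 \<le> a"
    using gamma_ratio_lt_1_small[of a] a by (cases "a < 1/3") (auto simp: alpha_star_eq_def)
  ultimately have a': "1/3 \<le> a" "a \<le> 2/3" by auto
  have a1: "0 < rGamma (1 - a)" using a by (intro rGamma_real_pos) auto
  have a3: "rGamma (1 - 3 * a) = (1 - 3 * a) * rGamma (2 - 3 * a)"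
    using rGamma_plus1[of "1 - 3 * a"] by (simp add: algebra_simps)
  have ge: "0 \<le> rGamma (2 - 3 * a)"
  proof (cases "a = 2/3")
    case True
    then have "2 - 3 * a = 0" by simp
    then show ?thesis by (simp only: rGamma_0)
  next
    case False
    then show ?thesis using a' by (intro less_imp_le rGamma_real_pos) simp
  qed
  have "rGamma (1 - a) * rGamma (1 - 3 * a) \<le> 0"
    unfolding a3 using a' a1 ge by (intro mult_nonneg_nonpos mult_nonpos_nonneg) auto
  moreover have eq: "(rGamma (1 - 2 * a))\<^sup>2 = rGamma (1 - a) * rGamma (1 - 3 * a)"
    using a by (simp add: alpha_star_eq_def)
  ultimately have "(rGamma (1 - 2 * a))\<^sup>2 = 0" by (metis order.antisym zero_le_power2)
  then have z: "rGamma (1 - 2 * a) = 0" by simp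
  then have "a = 1/2"
  proof -
    have "1 - 2 * a \<in> \<int>" using z nonpos_Ints_Int by (auto simp: rGamma_eq_zero_iff)
    then have "1 - 2 * a = 0" using a' by (intro Ints_nonzero_abs_less1) auto
    then show ?thesis by simp
  qed
  then have "rGamma (1 - 3 * a) \<noteq> 0"
    unfolding a3 using rGamma_real_pos[of "2 - 3 * a"] by auto
  then show False using eq z a1 by simp
qed

lemma alpha_star_eq_iff:
  assumes "1/2 < a" "a < 1"
  shows "alpha_star_eq a \<longleftrightarrow> gamma_ratio a = 1"
  using rGamma_1_minus_2_nonzero[OF assms] by (auto simp: alpha_star_eq_def gamma_ratio_def divide_eq_1_iff)

text \<open>The remainder bounds with \<open>z = 1 - 2 * a\<close>, \<open>d = a\<close> and
  \<open>m = 28\<close>: the 28 exact factors give enough precision to separate two decimals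
  differing by \<open>10^-6\<close>.\<close>

lemma
  fixes a A :: real
  defines "x \<equiv> 29 - 2 * a"
  defines "q \<equiv> (\<Prod>l<28. 1 - a\<^sup>2 / (1 - 2 * a + real l)\<^sup>2) * ((x - 1/2 - A) / (x - 1/2 + A))"
  assumes a: "2/3 < a" "a < 1" and A: "0 \<le> A"
  shows gamma_ratio_ge: "a\<^sup>2 \<le> 2 * A \<Longrightarrow> q \<le> gamma_ratio a"
    and gamma_ratio_le: "a\<^sup>2 * (1/2 - A)\<^sup>2 \<le> (a\<^sup>2 - 2 * A) * x\<^sup>2 \<Longrightarrow> 2 * A \<le> a\<^sup>2 \<Longrightarrow> gamma_ratio a \<le> q"
proof -
  define r where "r = pochhammer (1 - 2 * a - a) 28 * pochhammer (1 - 2 * a + a) 28 / (pochhammer (1 - 2 * a) 28)\<^sup>2"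
  have "r = (\<Prod>l<28. 1 - a\<^sup>2 / (1 - 2 * a + real l)\<^sup>2)"
    unfolding r_def
  proof (rule pochhammer_ratio_prod)
    fix l :: nat
    show "1 - 2 * a + real l \<noteq> 0" using a by (cases "l = 0") auto
  qed
  moreover have x: "x = 1 - 2 * a + real 28" by (simp add: x_def)
  ultimately have q: "q = r * ((1 - 2 * a + real 28 - 1/2 - A) / (1 - 2 * a + real 28 - 1/2 + A))"
    by (simp only: q_def)
  have g: "gamma_ratio a = rGamma (1 - 2 * a - a) * rGamma (1 - 2 * a + a) / (rGamma (1 - 2 * a))\<^sup>2"
    by (simp add: gamma_ratio_def mult.commute)
  have r0: "0 \<le> r"
    unfolding r_def using pochhammer_1_minus_3_pos[OF a, of 28] pochhammer_pos[of "1 - a" 28] a by simp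
  have nz: "rGamma (1 - 2 * a) \<noteq> 0" using a by (intro rGamma_1_minus_2_nonzero) auto
  have ax: "a\<^sup>2 \<le> (1 - 2 * a + real 28)\<^sup>2" using a by (intro power_mono) auto
  show "q \<le> gamma_ratio a" if "a\<^sup>2 \<le> 2 * A"
    unfolding q g r_def using that a by (intro pochhammer_ratio_ge nz A ax r0[unfolded r_def]) auto
  show "gamma_ratio a \<le> q" if "a\<^sup>2 * (1/2 - A)\<^sup>2 \<le> (a\<^sup>2 - 2 * A) * x\<^sup>2" "2 * A \<le> a\<^sup>2"
    unfolding q g r_def using that[unfolded x] a
    by (intro pochhammer_ratio_le nz A ax r0[unfolded r_def]) auto
qed

lemma gamma_ratio_771667: "gamma_ratio (771667/1000000) \<le> 1"
proof -
  have "gamma_ratio (771667/1000000) \<le> (\<Prod>l<28. 1 - (771667/1000000)\<^sup>2 / (1 - 2 * (771667/1000000) + real l)\<^sup>2)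
     * ((29 - 2 * (771667/1000000) - 1/2 - 2977/10000) / (29 - 2 * (771667/1000000) - 1/2 + 2977/10000))"
    by (rule gamma_ratio_le) (simp_all add: power2_eq_square)
  also have "\<dots> \<le> 1"
    by (simp add: lessThan_nat_numeral lessThan_Suc power2_eq_square)
  finally show ?thesis .
qed

lemma gamma_ratio_771668: "1 < gamma_ratio (771668/1000000)"
proof -
  have "1 < (\<Prod>l<28. 1 - (771668/1000000)\<^sup>2 / (1 - 2 * (771668/1000000) + real l)\<^sup>2)
     * ((29 - 2 * (771668/1000000) - 1/2 - 29774/100000) / (29 - 2 * (771668/1000000) - 1/2 + 29774/100000 :: real))"
    by (simp add: lessThan_nat_numeral lessThan_Suc power2_eq_square)
  also have "\<dots> \<le> gamma_ratio (771668/1000000)"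
    by (rule gamma_ratio_ge) (simp_all add: power2_eq_square)
  finally show ?thesis .
qed

subsection \<open>The main theorem\<close>

lemma rGamma_ineq_iff_gamma_ratio:
  assumes "2/3 < a" "a < 1"
  shows "rGamma (1 - a) * rGamma (1 - 3 * a) \<le> (rGamma (1 - 2 * a))\<^sup>2 \<longleftrightarrow> gamma_ratio a \<le> 1"
  using rGamma_1_minus_2_nonzero[of a] assms by (simp add: gamma_ratio_def divide_le_eq)

lemma alpha_star_ex1: "\<exists>!a. a \<in> {0<..<1} \<and> alpha_star_eq a"
proof -
  \<comment> \<open>The form without division is continuous everywhere and gives existence by the
    intermediate value theorem; uniqueness comes from the strictly monotone quotient.\<close>
  define g where "g a = (rGamma (1 - 2 * a))\<^sup>2 - rGamma (1 - a) * rGamma (1 - 3 * a)" for a :: real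
  have g: "isCont g a" for a
    unfolding g_def by (intro continuous_intros isCont_rGamma)
  have "g (771668/1000000) \<le> 0" "0 \<le> g (771667/1000000)"
    using gamma_ratio_771667 gamma_ratio_771668 rGamma_ineq_iff_gamma_ratio[of "771667/1000000"] rGamma_ineq_iff_gamma_ratio[of "771668/1000000"]
    by (simp_all add: g_def)
  then obtain a where a: "771667/1000000 \<le> a" "a \<le> 771668/1000000" "g a = 0"
    using IVT2[of g "771668/1000000" 0 "771667/1000000"] g by auto
  show ?thesis
  proof (rule ex1I[of _ a])
    show "a \<in> {0<..<1} \<and> alpha_star_eq a" using a by (auto simp: g_def alpha_star_eq_def)
    then have ra: "gamma_ratio a = 1" using a alpha_star_eq_iff[of a] by simp
    fix b assume b: "b \<in> {0<..<1} \<and> alpha_star_eq b"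
    then have b': "2/3 < b" "b < 1" using alpha_star_eq_imp_gt[of b] by auto
    then have "gamma_ratio b = 1" using b alpha_star_eq_iff[of b] by simp
    then show "b = a"
      using gamma_ratio_strict_mono[of a b] gamma_ratio_strict_mono[of b a] a b' ra
      by (cases a b rule: linorder_cases) auto
  qed
qed

lemma gamma_ratio_alpha_star: "gamma_ratio alpha_star = 1"
  and alpha_star_bounds: "771667/1000000 \<le> alpha_star" "alpha_star < 771668/1000000"
proof -
  have s: "alpha_star \<in> {0<..<1} \<and> alpha_star_eq alpha_star"
    unfolding alpha_star_def by (rule theI'[OF alpha_star_ex1])
  then have s': "2/3 < alpha_star" "alpha_star < 1" using alpha_star_eq_imp_gt by auto
  show r: "gamma_ratio alpha_star = 1" using s s' alpha_star_eq_iff by simp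
  show "771667/1000000 \<le> alpha_star"
    using gamma_ratio_strict_mono[of alpha_star "771667/1000000"] s' r gamma_ratio_771667
    by (cases "771667/1000000 \<le> alpha_star") auto
  show "alpha_star < 771668/1000000"
    using gamma_ratio_strict_mono[of "771668/1000000" alpha_star] s' r gamma_ratio_771668
    by (cases "771668/1000000 = alpha_star"; cases "771668/1000000 < alpha_star") auto
qed

text \<open>\<open>the_inv_into\<close> is a definite description, so uniqueness of the preimage at
  the single value in question suffices.\<close>

lemma gen_log_eq:
  assumes "t \<in> mittag_leffler_domain a"
    and "\<And>u. u \<in> mittag_leffler_domain a \<Longrightarrow> mittag_leffler a u = mittag_leffler a t \<Longrightarrow> u = t"
  shows "gen_log a (mittag_leffler a t) = t"
  unfolding gen_log_def the_inv_into_def using assms by (intro the_equality) auto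

text \<open>Here \<open>1 / F\<close> is the affine function \<open>1 + s\<close>.\<close>

lemma concave_on_neg_x_gen_log_0: "concave_on {0..1} (neg_x_gen_log 0)"
proof (rule concave_on_of_convex_on_inverse)
  define F :: "real \<Rightarrow> real" where "F s = 1 / (1 + s)" for s
  show "F t < F s" if "0 \<le> s" "s < t" for s t using that by (simp add: F_def divide_strict_left_mono)
  show "0 < F s" if "0 \<le> s" for s using that by (simp add: F_def)
  show "\<exists>s\<ge>0. F s = x" if "0 < x" "x \<le> 1" for x
    using that by (intro exI[of _ "1 / x - 1"]) (simp add: F_def)
  show "convex_on {0..} (\<lambda>s. 1 / F s)"
    by (intro convex_onI) (auto simp: F_def algebra_simps)
  show "((\<lambda>s. s * F s) \<longlongrightarrow> 1) at_top"
  proof -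
    have "((\<lambda>s::real. 1 - inverse (1 + s)) \<longlongrightarrow> 1 - 0) at_top"
      by (intro tendsto_intros tendsto_inverse_0_at_top filterlim_tendsto_add_at_top[OF tendsto_const filterlim_ident])
    moreover have "\<forall>\<^sub>F s in at_top. 1 - inverse (1 + s) = s * F s"
      using eventually_gt_at_top[of "0::real"] by eventually_elim (simp add: F_def field_simps)
    ultimately show ?thesis by (simp add: tendsto_cong)
  qed
  show "neg_x_gen_log 0 0 = 1" by (simp add: neg_x_gen_log_def rGamma_inverse_Gamma)
  show "neg_x_gen_log 0 (F s) = s * F s" if s: "0 \<le> s" for s
  proof -
    have "gen_log 0 (mittag_leffler 0 (- s)) = - s"
      using s by (intro gen_log_eq) (auto simp: mittag_leffler_domain_def mittag_leffler_def)
    moreover have "mittag_leffler 0 (- s) = F s" by (simp add: mittag_leffler_def F_def)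
    ultimately have "gen_log 0 (F s) = - s" by simp
    then show ?thesis using s by (simp add: neg_x_gen_log_def F_def)
  qed
qed

lemma mittag_leffler_1: "mittag_leffler 1 x = exp x"
proof -
  have "Gamma (1 + real n) = fact n" for n
    using Gamma_fact[of n, where 'a = real] by (simp add: add.commute)
  then show ?thesis
    by (simp add: mittag_leffler_def exp_def divide_inverse mult.commute)
qed

text \<open>Here \<open>1 / F\<close> is the exponential function, and \<open>s * exp (- s)\<close>
  tends to \<open>0 = rGamma 0\<close>.\<close>

lemma concave_on_neg_x_gen_log_1: "concave_on {0..1} (neg_x_gen_log 1)"
proof (rule concave_on_of_convex_on_inverse)
  define F :: "real \<Rightarrow> real" where "F s = exp (- s)" for s
  show "F t < F s" if "0 \<le> s" "s < t" for s t using that by (simp add: F_def)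
  show "0 < F s" for s by (simp add: F_def)
  show "\<exists>s\<ge>0. F s = x" if "0 < x" "x \<le> 1" for x
    using that by (intro exI[of _ "- ln x"]) (simp add: F_def)
  show "convex_on {0..} (\<lambda>s. 1 / F s)"
    using convex_on_subset[OF exp_convex, of "{0..}"] by (simp add: F_def exp_minus divide_inverse)
  show "((\<lambda>s. s * F s) \<longlongrightarrow> 0) at_top"
    using tendsto_power_div_exp_0[of 1] by (simp add: F_def exp_minus divide_inverse)
  show "neg_x_gen_log 1 0 = 0" by (simp add: neg_x_gen_log_def)
  show "neg_x_gen_log 1 (F s) = s * F s" for s
  proof -
    have "gen_log 1 (mittag_leffler 1 (- s)) = - s"
      by (intro gen_log_eq) (auto simp: mittag_leffler_domain_def mittag_leffler_1)
    then have "gen_log 1 (F s) = - s" by (simp add: F_def mittag_leffler_1)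
    then show ?thesis by (simp add: neg_x_gen_log_def F_def)
  qed
qed

lemma concave_on_neg_x_gen_log_iff:
  assumes a: "0 < a" "a < 1"
  shows "concave_on {0..1} (neg_x_gen_log a) \<longleftrightarrow> convex_on {0..} (\<lambda>s. 1 / mittag_leffler a (- s))"
proof -
  define F where "F s = mittag_leffler a (- s)" for s
  have anti: "F t < F s" if "0 \<le> s" "s < t" for s t
    unfolding F_def by (rule mittag_leffler_strict_antimono[OF a that])
  have pos: "0 < F s" if "0 \<le> s" for s
    unfolding F_def by (rule mittag_leffler_pos[OF a that])
  have F0: "F 0 = 1" by (simp add: F_def mittag_leffler_0)
  have le1: "F s \<le> 1" if "0 \<le> s" for s
    using anti[of 0 s] that F0 by (cases "s = 0") auto
  have surj: "\<exists>s\<ge>0. F s = x" if x: "0 < x" "x \<le> 1" for x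
  proof -
    have "\<forall>\<^sub>F s in at_top. F s < x \<and> 0 \<le> s"
      using order_tendstoD(2)[OF mittag_leffler_LIM_0[OF a] x(1)] eventually_ge_at_top[of "0::real"]
      unfolding F_def by eventually_elim simp
    then obtain T where T: "F T < x" "0 \<le> T" by (auto simp: eventually_at_top_linorder)
    have "isCont F s" for s
      unfolding F_def
      by (rule isCont_o2[where f = uminus and g = "mittag_leffler a"])
         (auto intro: continuous_intros isCont_mittag_leffler a)
    then show ?thesis using IVT2[of F T x 0] T x F0 by auto
  qed
  have h: "neg_x_gen_log a (F s) = s * F s" if s: "0 \<le> s" for s
  proof -
    have "gen_log a (mittag_leffler a (- s)) = - s"
    proof (rule gen_log_eq)
      fix u assume u: "mittag_leffler a u = mittag_leffler a (- s)"
      \<comment> \<open>Values of the Mittag-Leffler function at positive arguments exceed 1, while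
        \<open>F s <= 1\<close>.\<close>
      then have "u \<le> 0" using mittag_leffler_gt_1[of a u] a le1[OF s] by (force simp: F_def)
      moreover have "F (- u) = F s" using u by (simp add: F_def)
      ultimately show "u = - s"
        using anti[of s "- u"] anti[of "- u" s] s by (cases "- u" s rule: linorder_cases) auto
    qed (use a in \<open>simp add: mittag_leffler_domain_def\<close>)
    then show ?thesis using pos[OF s] by (simp add: neg_x_gen_log_def F_def)
  qed
  show ?thesis
  proof
    assume "concave_on {0..1} (neg_x_gen_log a)"
    then have "convex_on {0..} (\<lambda>s. 1 / F s)"
      by (intro convex_on_inverse_of_concave_on[where h = "neg_x_gen_log a"] anti pos le1 surj h)
    then show "convex_on {0..} (\<lambda>s. 1 / mittag_leffler a (- s))" by (simp add: F_def)
  next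
    assume "convex_on {0..} (\<lambda>s. 1 / mittag_leffler a (- s))"
    then have conv: "convex_on {0..} (\<lambda>s. 1 / F s)" by (simp add: F_def)
    have lim: "((\<lambda>s. s * F s) \<longlongrightarrow> rGamma (1 - a)) at_top"
      unfolding F_def by (rule mittag_leffler_times_LIM[OF a])
    show "concave_on {0..1} (neg_x_gen_log a)"
      by (rule concave_on_of_convex_on_inverse[OF anti pos surj conv lim _ h]) (auto simp: neg_x_gen_log_def)
  qed
qed

theorem theoremC:
  shows "(\<exists>!a. a \<in> {0<..<1} \<and> alpha_star_eq a) \<and>
         0.771667 \<le> alpha_star \<and> alpha_star < 0.771668 \<and>
         (\<forall>\<alpha>\<in>{0..1}. concave_on {0..1} (neg_x_gen_log \<alpha>) \<longleftrightarrow> \<alpha> \<le> alpha_star \<or> \<alpha> = 1)"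
proof (intro conjI ballI)
  show "\<exists>!a. a \<in> {0<..<1} \<and> alpha_star_eq a" by (rule alpha_star_ex1)
  show "0.771667 \<le> alpha_star" "alpha_star < 0.771668"
    using alpha_star_bounds by simp_all
  fix \<alpha> :: real assume \<alpha>: "\<alpha> \<in> {0..1}"
  consider "\<alpha> = 0" | "\<alpha> = 1" | "0 < \<alpha>" "\<alpha> < 1" "\<alpha> \<le> alpha_star" | "\<alpha> < 1" "alpha_star < \<alpha>"
    using \<alpha> by force
  then show "concave_on {0..1} (neg_x_gen_log \<alpha>) \<longleftrightarrow> \<alpha> \<le> alpha_star \<or> \<alpha> = 1"
  proof cases
    case 1
    then show ?thesis using concave_on_neg_x_gen_log_0 alpha_star_bounds by simp
  next
    case 2
    then show ?thesis using concave_on_neg_x_gen_log_1 by simp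
  next
    case 3
    \<comment> \<open>Since \<open>5/7 > 2/3\<close>, this range lies in the domain of strict
      monotonicity of \<open>gamma_ratio\<close>, which reaches 1 at
      \<open>alpha_star\<close>.\<close>
    have ratio: "rGamma (1 - \<alpha>) * rGamma (1 - 3 * \<alpha>) \<le> (rGamma (1 - 2 * \<alpha>))\<^sup>2" if "5/7 < \<alpha>"
      using gamma_ratio_strict_mono[of \<alpha> alpha_star] gamma_ratio_alpha_star alpha_star_bounds 3 that
      by (subst rGamma_ineq_iff_gamma_ratio) (auto simp: le_less)
    have disc: "0 \<le> crp_disc \<alpha> m j" if "7 \<le> m" "2 \<le> j" for m j
      using 3 alpha_star_bounds that ratio by (intro crp_disc_nonneg) auto
    have "convex_on {0..} (\<lambda>s. 1 / mittag_leffler \<alpha> (- s))"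
    proof (rule convex_on_inverse_mittag_leffler)
      show "\<forall>\<^sub>F m in sequentially. \<forall>j\<ge>2. crp \<alpha> m (j - 1) * crp \<alpha> m (j + 1) \<le> (crp \<alpha> m j)\<^sup>2"
        using eventually_ge_at_top[of 7]
      proof eventually_elim
        case (elim m)
        then show ?case using disc[of m] by (simp add: crp_disc_def)
      qed
    qed (use 3 in auto)
    then show ?thesis using 3 by (simp add: concave_on_neg_x_gen_log_iff)
  next
    case 4
    then have \<alpha>': "2/3 < \<alpha>" "0 < \<alpha>" using alpha_star_bounds by auto
    have "1 < gamma_ratio \<alpha>"
      using gamma_ratio_strict_mono[of alpha_star \<alpha>] gamma_ratio_alpha_star alpha_star_bounds 4 by simp
    then have "(rGamma (1 - 2 * \<alpha>))\<^sup>2 < rGamma (1 - \<alpha>) * rGamma (1 - 3 * \<alpha>)"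
      using rGamma_ineq_iff_gamma_ratio[OF \<alpha>'(1) 4(1)] by linarith
    then show ?thesis
      using not_convex_on_inverse_mittag_leffler[OF \<alpha>'(2) 4(1)] 4 \<alpha>'
      by (simp add: concave_on_neg_x_gen_log_iff)
  qed
qed

end
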